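(* For every computable time bound $t$ there is a constant $d_t$ such that $R_K\notin \text{i.o.-DTIME}(t)/2^{n-d_t}$.
   Context: Fix a universal Turing machine $U$; $K(x)=\min\{|p| : U(p)=x\}$ and $R_K=\{x\in\{0,1\}^* : K(x)\ge |x|\}$. For a set $A$, $A^{=n}=A\cap\{0,1\}^n$. Advice computation: a machine $M$ gets input $(x,\alpha(|x|))$, has random access to its input (so the advice may be longer than the running time), and its running time is measured as a function of $|x|$. $L\in\text{i.o.-DTIME}(t)/f$ means there exist a Turing machine $M$ that on every input $(x,\beta)$ runs in time $t(|x|)$, and an advice function $\alpha:\mathbb N\to\{0,1\}^*$ with $|\alpha(n)|\le f(n)$, such that for infinitely many $n$, $L^{=n}=\{x\in\{0,1\}^n : M(x,\alpha(n))\text{ accepts}\}$. *)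

theory Defs
  imports Complex_Main
begin

datatype sym = Bl | Zs | Os

datatype dir = Lft | Stay | Rgt

text \<open>A machine: number of states and a transition function.  State 0 is the start
state, state 1 is the accepting halting state, state 2 the rejecting halting state.
The transition depends on the current state, the input symbol at the current address
(random access), the symbol under the work-tape head and the symbol under the
index-tape head.  It returns the new state, the symbol written and move on the work
tape, and the symbol written and move on the index tape.\<close>
record tm =
  nst :: nat
  delta :: "nat \<Rightarrow> sym \<Rightarrow> sym \<Rightarrow> sym \<Rightarrow> nat \<times> sym \<times> dir \<times> sym \<times> dir"

definition wf_tm :: "tm \<Rightarrow> bool" where
  "wf_tm M \<longleftrightarrow> 3 \<le> nst M \<and>
     (\<forall>q<nst M. \<forall>a b c. fst (delta M q a b c) < nst M)"

text \<open>Configuration: state, work tape, work head, index tape, index head.\<close>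
type_synonym config = "nat \<times> (int \<Rightarrow> sym) \<times> int \<times> (nat \<Rightarrow> sym) \<times> nat"

definition halted_state :: "nat \<Rightarrow> bool" where
  "halted_state q \<longleftrightarrow> q = 1 \<or> q = 2"

definition addr :: "(nat \<Rightarrow> sym) \<Rightarrow> nat" where
  "addr T = (\<Sum>i < (LEAST j. T j = Bl). if T i = Os then 2 ^ i else 0)"

fun mv_int :: "int \<Rightarrow> dir \<Rightarrow> int" where
  "mv_int h Lft = h - 1" | "mv_int h Stay = h" | "mv_int h Rgt = h + 1"

fun mv_nat :: "nat \<Rightarrow> dir \<Rightarrow> nat" where
  "mv_nat h Lft = h - 1" | "mv_nat h Stay = h" | "mv_nat h Rgt = h + 1"

text \<open>An input is a function from addresses to symbols (blank outside the input).\<close>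
definition step :: "tm \<Rightarrow> (nat \<Rightarrow> sym) \<Rightarrow> config \<Rightarrow> config" where
  "step M inp c = (case c of (q, W, wh, I, ih) \<Rightarrow>
     if halted_state q then c else
     (case delta M q (inp (addr I)) (W wh) (I ih) of (q', w, dw, i, di) \<Rightarrow>
        (q', W(wh := w), mv_int wh dw, I(ih := i), mv_nat ih di)))"

definition init_config :: config where
  "init_config = (0, \<lambda>_. Bl, 0, \<lambda>_. Bl, 0)"

definition run :: "tm \<Rightarrow> (nat \<Rightarrow> sym) \<Rightarrow> nat \<Rightarrow> config" where
  "run M inp n = (step M inp ^^ n) init_config"

definition cstate :: "config \<Rightarrow> nat" where
  "cstate c = fst c"

definition tm_output :: "config \<Rightarrow> bool list" where
  "tm_output c = (case c of (q, W, wh, I, ih) \<Rightarrow>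
     map (\<lambda>i. W (int i) = Os) [0..<(LEAST j. W (int j) = Bl)])"

definition bitsym :: "bool \<Rightarrow> sym" where
  "bitsym b = (if b then Os else Zs)"

definition enc1 :: "bool list \<Rightarrow> nat \<Rightarrow> sym" where
  "enc1 w i = (if i < length w then bitsym (w ! i) else Bl)"

text \<open>Encoding of a pair (x, beta): interleaved, x at even addresses, beta at odd
addresses, so both components are randomly accessible.\<close>
definition enc2 :: "bool list \<Rightarrow> bool list \<Rightarrow> nat \<Rightarrow> sym" where
  "enc2 x b i = (if even i then enc1 x (i div 2) else enc1 b (i div 2))"

definition eval :: "tm \<Rightarrow> bool list \<Rightarrow> bool list option" where
  "eval M w = (if \<exists>n. halted_state (cstate (run M (enc1 w) n))
     then Some (tm_output (run M (enc1 w) (LEAST n. halted_state (cstate (run M (enc1 w) n)))))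
     else None)"

definition universal :: "tm \<Rightarrow> bool" where
  "universal U \<longleftrightarrow> wf_tm U \<and>
     (\<forall>M. wf_tm M \<longrightarrow> (\<exists>c. \<forall>p. eval U (c @ p) = eval M p))"

definition K :: "tm \<Rightarrow> bool list \<Rightarrow> nat" where
  "K U x = (LEAST n. \<exists>p. length p = n \<and> eval U p = Some x)"

definition R_K :: "tm \<Rightarrow> bool list set" where
  "R_K U = {x. K U x \<ge> length x}"

fun nat_bits :: "nat \<Rightarrow> bool list" where
  "nat_bits n = (if n = 0 then [] else odd n # nat_bits (n div 2))"

definition computable_nat_fn :: "(nat \<Rightarrow> nat) \<Rightarrow> bool" where
  "computable_nat_fn t \<longleftrightarrow>
     (\<exists>M. wf_tm M \<and> (\<forall>n. eval M (nat_bits n) = Some (nat_bits (t n))))"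

definition io_DTIME_adv :: "(nat \<Rightarrow> nat) \<Rightarrow> (nat \<Rightarrow> real) \<Rightarrow> bool list set set" where
  "io_DTIME_adv t f = {L. \<exists>M \<alpha>. wf_tm M \<and>
     (\<forall>n. real (length (\<alpha> n)) \<le> f n) \<and>
     (\<forall>x \<beta>. halted_state (cstate (run M (enc2 x \<beta>) (t (length x))))) \<and>
     infinite {n. \<forall>x. length x = n \<longrightarrow>
        (x \<in> L \<longleftrightarrow> cstate (run M (enc2 x (\<alpha> n)) (t n)) = 1)}}"

end

(* Fix a prefix c with U (c @ p) = [] for all p: it wastes a constant fraction of the programs of
   length below n, so at least 2^(n-k) words of length n are random, for a constant k.  If a machine
   with advice of length at most B = 2^(n-d) decided randomness at length n, the set it accepts would
   be one of about n 2^(2B) sets (one of the first n machines, cut off at a computable time bound),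
   and of density at least 2^-k.  A greedy choice finds 2^k (n + 2B + 1) words meeting all such dense
   sets, and searching for such a list is computable, uniformly in the machine; hence d need not
   depend on it.  Each word on the list is described by its index, with n = l + 2^a read off the
   length l of the index and a unary suffix of length a, so for large a it has a program shorter
   than n: some accepted word is not random.

   Computability of the search: a class of functions closed under pairing, iteration and
   unbounded search, compiled to counter programs and these to the machine model. *)
theory Submission
  imports Defs "HOL-Library.Nat_Bijection"
begin

section \<open>Structured programs on the machine model\<close>

text \<open>Counting all programs shorter than n leaves only one random word of length n, and a set
  that small can escape a short list; the positive density won from the wasted prefix is what a
  hitting list can use. The greedy list takes 2^k times the logarithm of the number of sets, and
  that logarithm is about 2B: hence advice of length 2^(n-d) is the point at which indices become
  shorter than n.

  The constants threaten to be circular. The list depends on d through B, while the number of bits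
  saved has to beat the length of the prefix under which U runs the program for the list. So that
  program does not contain d: it recovers a, and with it d = 2^a + k + 2, from its input, and a is
  fixed once the prefix is known. The unary suffix costs a + 1 bits, and 2^a are saved.

  The cutoff makes acceptance decidable for every machine code and every advice, also where the
  machine never halts, so the search needs no promise about them. The running times of the
  constructed machines do not matter, only that they halt.\<close>

type_synonym tapes = "(nat \<Rightarrow> sym) \<times> (int \<Rightarrow> sym) \<times> int \<times> (nat \<Rightarrow> sym) \<times> nat"

definition reaches :: "tm \<Rightarrow> nat \<Rightarrow> tapes \<Rightarrow> nat \<Rightarrow> tapes \<Rightarrow> bool" where
  "reaches M a s b s' \<longleftrightarrow>
     fst s' = fst s \<and> (\<exists>n. (step M (fst s) ^^ n) (a, snd s) = (b, snd s'))"

lemma reaches_trans: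
  assumes "reaches M a s b s'" "reaches M b s' c s''"
  shows "reaches M a s c s''"
proof -
  obtain m n where "(step M (fst s) ^^ m) (a, snd s) = (b, snd s')"
    "(step M (fst s) ^^ n) (b, snd s') = (c, snd s'')" and "fst s' = fst s" "fst s'' = fst s"
    using assms unfolding reaches_def by auto
  then have "(step M (fst s) ^^ (n + m)) (a, snd s) = (c, snd s'')"
    by (simp add: funpow_add)
  with \<open>fst s'' = fst s\<close> show ?thesis unfolding reaches_def by blast
qed

definition single :: "(sym \<Rightarrow> sym \<Rightarrow> sym \<Rightarrow> sym \<times> dir \<times> sym \<times> dir) \<Rightarrow> tapes \<Rightarrow> tapes" where
  "single act s = (case s of (inp, W, wh, I, ih) \<Rightarrow>
     (case act (inp (addr I)) (W wh) (I ih) of (w, dw, i, di) \<Rightarrow>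
       (inp, W(wh := w), mv_int wh dw, I(ih := i), mv_nat ih di)))"

definition holds :: "(sym \<Rightarrow> sym \<Rightarrow> sym \<Rightarrow> bool) \<Rightarrow> tapes \<Rightarrow> bool" where
  "holds \<phi> s = (case s of (inp, W, wh, I, ih) \<Rightarrow> \<phi> (inp (addr I)) (W wh) (I ih))"

lemma reaches_single:
  assumes "\<not> halted_state a"
    and "\<And>x y z. delta M a x y z = (if \<phi> x y z then b else c, act x y z)"
  shows "reaches M a s (if holds \<phi> s then b else c) (single act s)"
proof -
  obtain inp W wh I ih where s: "s = (inp, W, wh, I, ih)" by (cases s) auto
  have "(step M (fst s) ^^ 1) (a, snd s) = (if holds \<phi> s then b else c, snd (single act s))"
    using assms(1) by (simp add: s step_def single_def holds_def assms(2) split: prod.split)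
  moreover have "fst (single act s) = fst s" by (simp add: s single_def split: prod.split)
  ultimately show ?thesis unfolding reaches_def by blast
qed

text \<open>Blocks are relocatable: \<open>a\<close> is the first state and \<open>b\<close> the exit state.  Starting at 3 keeps
  clear of the initial and the halting states.\<close>
definition block :: "nat \<Rightarrow> (nat \<Rightarrow> nat \<Rightarrow> nat \<Rightarrow> sym \<Rightarrow> sym \<Rightarrow> sym \<Rightarrow> nat \<times> sym \<times> dir \<times> sym \<times> dir) \<Rightarrow>
    (tapes \<times> tapes) set \<Rightarrow> bool" where
  "block n G R \<longleftrightarrow> 0 < n \<and>
     (\<forall>a b q x y z. a \<le> q \<and> q < a + n \<longrightarrow> fst (G a b q x y z) \<in> {a..<a + n} \<union> {b}) \<and>
     (\<forall>M a b s s'. 3 \<le> a \<longrightarrow> (\<forall>q. a \<le> q \<and> q < a + n \<longrightarrow> delta M q = G a b q) \<longrightarrow>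
        (s, s') \<in> R \<longrightarrow> reaches M a s b s')"

text \<open>The relation is a guarantee, not a full description: states outside its domain are
  unconstrained, nontermination included. Hence it may always be shrunk, as in
  \<open>realizable_mono\<close>.\<close>

definition realizable :: "(tapes \<times> tapes) set \<Rightarrow> bool" where
  "realizable R \<longleftrightarrow> (\<exists>n G. block n G R)"

lemma blockI:
  assumes "0 < n" and "\<And>a b q x y z. a \<le> q \<Longrightarrow> q < a + n \<Longrightarrow> fst (G a b q x y z) \<in> {a..<a + n} \<union> {b}"
    and "\<And>M a b s s'. 3 \<le> a \<Longrightarrow> (\<And>q. a \<le> q \<Longrightarrow> q < a + n \<Longrightarrow> delta M q = G a b q) \<Longrightarrow>
        (s, s') \<in> R \<Longrightarrow> reaches M a s b s'"
  shows "block n G R"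
  unfolding block_def
proof (intro conjI allI impI assms(1))
  fix a b q x y z assume "a \<le> q \<and> q < a + n"
  then show "fst (G a b q x y z) \<in> {a..<a + n} \<union> {b}" using assms(2) by blast
next
  fix M :: tm and a b s s'
  assume "3 \<le> a" "\<forall>q. a \<le> q \<and> q < a + n \<longrightarrow> delta M q = G a b q" "(s, s') \<in> R"
  then show "reaches M a s b s'" using assms(3)[of a M b s s'] by blast
qed

lemma block_pos: "block n G R \<Longrightarrow> 0 < n"
  unfolding block_def by blast

lemma block_exit:
  "block n G R \<Longrightarrow> a \<le> q \<Longrightarrow> q < a + n \<Longrightarrow> fst (G a b q x y z) \<in> {a..<a + n} \<union> {b}"
  unfolding block_def by blast

lemma block_reaches:
  assumes "block n G R" "3 \<le> a" "\<And>q. a \<le> q \<Longrightarrow> q < a + n \<Longrightarrow> delta M q = G a b q" "(s, s') \<in> R"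
  shows "reaches M a s b s'"
proof -
  have "\<forall>q. a \<le> q \<and> q < a + n \<longrightarrow> delta M q = G a b q" using assms(3) by simp
  then show ?thesis using assms(1,2,4) unfolding block_def by blast
qed

lemma realizable_mono:
  assumes "realizable R" "S \<subseteq> R"
  shows "realizable S"
proof -
  obtain n G where G: "block n G R" using assms(1) unfolding realizable_def by auto
  have "block n G S"
    by (rule blockI) (use block_pos[OF G] block_exit[OF G] block_reaches[OF G] assms(2) in auto)
  then show ?thesis unfolding realizable_def by blast
qed

lemma realizable_single: "realizable {(s, single act s) | s. True}"
  unfolding realizable_def
proof (intro exI)
  show "block 1 (\<lambda>a b q x y z. (b, act x y z)) {(s, single act s) | s. True}"
  proof (rule blockI)
    fix M :: tm and a b s s'
    assume "3 \<le> (a::nat)" and "\<And>q. a \<le> q \<Longrightarrow> q < a + 1 \<Longrightarrow> delta M q = (\<lambda>x y z. (b, act x y z))"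
      and "(s, s') \<in> {(s, single act s) | s. True}"
    then have "delta M a = (\<lambda>x y z. (b, act x y z))" "s' = single act s" by auto
    then show "reaches M a s b s'"
      using \<open>3 \<le> a\<close> reaches_single[of a M "\<lambda>_ _ _. True" b b act s]
      by (simp add: halted_state_def)
  qed simp_all
qed

lemma realizable_comp:
  assumes "realizable R" "realizable S"
  shows "realizable (R O S)"
proof -
  obtain m G where G: "block m G R" using assms(1) unfolding realizable_def by auto
  obtain n H where H: "block n H S" using assms(2) unfolding realizable_def by auto
  define J where "J = (\<lambda>a b q. if q < a + m then G a (a + m) q else H (a + m) b q)"
  have "block (m + n) J (R O S)"
  proof (rule blockI)
    fix a b q x y z assume q: "a \<le> q" "q < a + (m + n)"
    show "fst (J a b q x y z) \<in> {a..<a + (m + n)} \<union> {b}"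
    proof (cases "q < a + m")
      case True
      with block_exit[OF G q(1) True, of "a + m" x y z] block_pos[OF H] show ?thesis
        by (auto simp: J_def)
    next
      case False
      with block_exit[OF H, of "a + m" q b x y z] q show ?thesis
        by (auto simp: J_def)
    qed
  next
    fix M :: tm and a b s s'
    assume a: "3 \<le> a" and d: "\<And>q. a \<le> q \<Longrightarrow> q < a + (m + n) \<Longrightarrow> delta M q = J a b q"
      and "(s, s') \<in> R O S"
    then obtain s1 where s1: "(s, s1) \<in> R" "(s1, s') \<in> S" by auto
    have "reaches M a s (a + m) s1"
      by (rule block_reaches[OF G a _ s1(1)]) (use d in \<open>auto simp: J_def\<close>)
    moreover have "reaches M (a + m) s1 b s'"
      by (rule block_reaches[OF H _ _ s1(2)]) (use a d in \<open>auto simp: J_def\<close>)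
    ultimately show "reaches M a s b s'" by (rule reaches_trans)
  qed (use block_pos[OF G] in simp)
  then show ?thesis unfolding realizable_def by blast
qed

lemma single_noop: "single (\<lambda>x y z. (y, Stay, z, Stay)) s = s"
  by (cases s) (simp add: single_def)

text \<open>Both control structures put one testing state in front of the block of the body, which
  either enters the body or exits; they differ in the exit state of the body.\<close>
lemma branch_block:
  fixes \<phi> :: "sym \<Rightarrow> sym \<Rightarrow> sym \<Rightarrow> bool"
  assumes G: "block n G R" and e: "\<And>a b. e a b = a \<or> e a b = b"
    and J: "J = (\<lambda>a b q. if q = a then (\<lambda>x y z. (if \<phi> x y z then a + 1 else b, y, Stay, z, Stay))
              else G (a + 1) (e a b) q)"
    and S: "\<And>M a b s s'. (s, s') \<in> S \<Longrightarrow>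
      (\<And>s. holds \<phi> s \<Longrightarrow> reaches M a s (a + 1) s) \<Longrightarrow>
      (\<And>s. \<not> holds \<phi> s \<Longrightarrow> reaches M a s b s) \<Longrightarrow>
      (\<And>s s'. (s, s') \<in> R \<Longrightarrow> reaches M (a + 1) s (e a b) s') \<Longrightarrow> reaches M a s b s'"
  shows "block (Suc n) J S"
proof (rule blockI)
  fix a b q x y z assume q: "a \<le> q" "q < a + Suc n"
  show "fst (J a b q x y z) \<in> {a..<a + Suc n} \<union> {b}"
    using block_exit[OF G, of "a + 1" q "e a b" x y z] block_pos[OF G] q e[of a b]
    by (cases "q = a") (auto simp: J)
next
  fix M :: tm and a b s s'
  assume a: "3 \<le> a" and d: "\<And>q. a \<le> q \<Longrightarrow> q < a + Suc n \<Longrightarrow> delta M q = J a b q"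
    and s: "(s, s') \<in> S"
  have "delta M a x y z = (if \<phi> x y z then a + 1 else b, y, Stay, z, Stay)" for x y z
    using d[of a] by (simp add: J)
  then have t: "reaches M a s (if holds \<phi> s then a + 1 else b) s" for s
    using reaches_single[of a M \<phi> "a + 1" b "\<lambda>x y z. (y, Stay, z, Stay)" s] a
    by (simp add: halted_state_def single_noop)
  show "reaches M a s b s'"
  proof (rule S[OF s])
    show "reaches M a s (a + 1) s" if "holds \<phi> s" for s using t[of s] that by simp
    show "reaches M a s b s" if "\<not> holds \<phi> s" for s using t[of s] that by simp
    show "reaches M (a + 1) s (e a b) s'" if "(s, s') \<in> R" for s s'
      by (rule block_reaches[OF G _ _ that]) (use a d in \<open>auto simp: J\<close>)
  qed
qed simp

lemma realizable_if:
  assumes "realizable R"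
  shows "realizable ({(s, s'). (s, s') \<in> R \<and> holds \<phi> s} \<union> {(s, s'). s' = s \<and> \<not> holds \<phi> s})"
    (is "realizable ?S")
proof -
  obtain n G where G: "block n G R" using assms unfolding realizable_def by auto
  have key: "reaches M a s b s'"
    if s: "(s, s') \<in> ?S"
      and 1: "\<And>s. holds \<phi> s \<Longrightarrow> reaches M a s (a + 1) s"
      and 2: "\<And>s. \<not> holds \<phi> s \<Longrightarrow> reaches M a s b s"
      and 3: "\<And>s s'. (s, s') \<in> R \<Longrightarrow> reaches M (a + 1) s b s'"
    for M a b s s'
  proof (cases "holds \<phi> s")
    case True
    with s show ?thesis using reaches_trans[OF 1 3] by simp
  next
    case False
    with s show ?thesis using 2 by simp
  qed
  have "block (Suc n) (\<lambda>a b q. if q = a then (\<lambda>x y z. (if \<phi> x y z then a + 1 else b, y, Stay, z, Stay))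
      else G (a + 1) b q) ?S"
    by (rule branch_block[OF G, where e = "\<lambda>a b. b" and \<phi> = \<phi>], simp, rule refl, erule key)
  then show ?thesis unfolding realizable_def by (intro exI)
qed

text \<open>Termination is not a premise but part of the relation: a pair is present only if
  finitely many passes lead out of the loop. Decreasing measures enter with
  \<open>real_fun_while\<close>.\<close>

lemma realizable_while:
  assumes "realizable R"
  shows "realizable {(s, s'). (s, s') \<in> {(s, s'). (s, s') \<in> R \<and> holds \<phi> s}\<^sup>* \<and> \<not> holds \<phi> s'}"
    (is "realizable ?S")
proof -
  obtain n G where G: "block n G R" using assms unfolding realizable_def by auto
  have key: "reaches M a s b s'"
    if s: "(s, s') \<in> ?S"
      and 1: "\<And>s. holds \<phi> s \<Longrightarrow> reaches M a s (a + 1) s"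
      and 2: "\<And>s. \<not> holds \<phi> s \<Longrightarrow> reaches M a s b s"
      and 3: "\<And>s s'. (s, s') \<in> R \<Longrightarrow> reaches M (a + 1) s a s'"
    for M a b s s'
  proof -
    have "(s, s') \<in> {(s, s'). (s, s') \<in> R \<and> holds \<phi> s}\<^sup>*" and h: "\<not> holds \<phi> s'" using s by auto
    then show ?thesis
    proof (induction s rule: converse_rtrancl_induct)
      case base
      then show ?case by (rule 2)
    next
      case (step s s1)
      then have "reaches M a s (a + 1) s" "reaches M (a + 1) s a s1" "reaches M a s1 b s'"
        using 1 3 by auto
      then show ?case using reaches_trans by blast
    qed
  qed
  have "block (Suc n) (\<lambda>a b q. if q = a then (\<lambda>x y z. (if \<phi> x y z then a + 1 else b, y, Stay, z, Stay))
      else G (a + 1) a q) ?S"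
    by (rule branch_block[OF G, where e = "\<lambda>a b. a" and \<phi> = \<phi>], simp, rule refl, erule key)
  then show ?thesis unfolding realizable_def by (intro exI)
qed

lemma realizable_id: "realizable Id"
  by (rule realizable_mono[OF realizable_single[of "\<lambda>x y z. (y, Stay, z, Stay)"]])
    (auto simp: single_noop)

section \<open>Counters on the work tape\<close>

definition on_work :: "(((int \<Rightarrow> sym) \<times> int) \<times> ((int \<Rightarrow> sym) \<times> int)) set \<Rightarrow> (tapes \<times> tapes) set" where
  "on_work T = {((inp, W, wh, I, ih), (inp, W', wh', I, ih)) | inp W wh I ih W' wh'.
     ((W, wh), (W', wh')) \<in> T}"

lemma on_workI: "((W, wh), (W', wh')) \<in> T \<Longrightarrow> ((inp, W, wh, I, ih), (inp, W', wh', I, ih)) \<in> on_work T"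
  unfolding on_work_def by blast

lemma on_work_mono: "S \<subseteq> T \<Longrightarrow> on_work S \<subseteq> on_work T"
  unfolding on_work_def by blast

lemma on_work_comp: "on_work (S O T) \<subseteq> on_work S O on_work T"
  unfolding on_work_def by (auto simp: relcomp_unfold) blast

lemma work_comp: "realizable (on_work S) \<Longrightarrow> realizable (on_work T) \<Longrightarrow> realizable (on_work (S O T))"
  by (rule realizable_mono[OF realizable_comp on_work_comp])

lemma work_single: "realizable (on_work {((W, wh), (W(wh := f (W wh)), mv_int wh d)) | W wh. True})"
  by (rule realizable_mono[OF realizable_single[of "\<lambda>x y z. (f y, d, z, Stay)"]])
    (auto simp: on_work_def single_def)

definition shift :: "int \<Rightarrow> (((int \<Rightarrow> sym) \<times> int) \<times> ((int \<Rightarrow> sym) \<times> int)) set" where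
  "shift d = {((W, wh), (W, wh + d)) | W wh. True}"

lemma shift_add: "shift (a + b) \<subseteq> shift a O shift b"
  by (auto simp: shift_def relcomp_unfold)

lemma work_shift_nat:
  assumes "realizable (on_work (shift d))"
  shows "realizable (on_work (shift (int n * d)))"
proof (induction n)
  case 0
  show ?case
    by (rule realizable_mono[OF realizable_id]) (auto simp: shift_def on_work_def)
next
  case (Suc n)
  have "shift (int (Suc n) * d) \<subseteq> shift (int n * d) O shift d"
    using shift_add[of "int n * d" d] by (simp add: algebra_simps)
  then show ?case
    using realizable_mono[OF work_comp[OF Suc assms]] on_work_mono by blast
qed

lemma work_shift: "realizable (on_work (shift d))"
proof -
  have 1: "realizable (on_work (shift 1))"
    by (rule realizable_mono[OF work_single[of "\<lambda>x. x" Rgt]]) (auto simp: shift_def on_work_def)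
  have 2: "realizable (on_work (shift (- 1)))"
    by (rule realizable_mono[OF work_single[of "\<lambda>x. x" Lft]]) (auto simp: shift_def on_work_def)
  show ?thesis
    using work_shift_nat[OF 1, of "nat d"] work_shift_nat[OF 2, of "nat (- d)"]
    by (cases "d \<ge> 0") auto
qed

definition scan :: "(sym \<Rightarrow> bool) \<Rightarrow> int \<Rightarrow> (((int \<Rightarrow> sym) \<times> int) \<times> ((int \<Rightarrow> sym) \<times> int)) set" where
  "scan \<phi> d = {((W, wh), (W, wh + int j * d)) | W wh j.
     (\<forall>i<j. \<phi> (W (wh + int i * d))) \<and> \<not> \<phi> (W (wh + int j * d))}"

lemma scanI:
  "(\<And>i. i < j \<Longrightarrow> \<phi> (W (wh + int i * d))) \<Longrightarrow> \<not> \<phi> (W wh') \<Longrightarrow> wh' = wh + int j * d \<Longrightarrow>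
   ((W, wh), (W, wh')) \<in> scan \<phi> d"
  unfolding scan_def by blast

lemma work_scan: "realizable (on_work (scan \<phi> d))"
proof -
  let ?\<phi> = "\<lambda>x y z. \<phi> y"
  let ?R = "{(s, s'). (s, s') \<in> on_work (shift d) \<and> holds ?\<phi> s}"
  have star: "((inp, W, wh, I, ih), (inp, W, wh + int j * d, I, ih)) \<in> ?R\<^sup>*"
    if "\<forall>i<j. \<phi> (W (wh + int i * d))" for inp W wh I ih j
    using that
  proof (induction j)
    case (Suc j)
    then have 1: "((inp, W, wh, I, ih), (inp, W, wh + int j * d, I, ih)) \<in> ?R\<^sup>*" by simp
    have 2: "((inp, W, wh + int j * d, I, ih), (inp, W, wh + int (Suc j) * d, I, ih)) \<in> ?R"
      using Suc.prems by (auto simp: on_work_def shift_def holds_def algebra_simps)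
    from 1 2 show ?case by (rule rtrancl_into_rtrancl)
  qed simp
  show ?thesis
  proof (rule realizable_mono[OF realizable_while[OF work_shift[of d], of ?\<phi>]])
    show "on_work (scan \<phi> d) \<subseteq> {(s, s'). (s, s') \<in> ?R\<^sup>* \<and> \<not> holds ?\<phi> s'}"
      using star by (auto simp: on_work_def scan_def holds_def)
  qed
qed

definition put :: "sym \<Rightarrow> (((int \<Rightarrow> sym) \<times> int) \<times> ((int \<Rightarrow> sym) \<times> int)) set" where
  "put a = {((W, wh), (W(wh := a), wh)) | W wh. True}"

lemma work_put: "realizable (on_work (put a))"
  by (rule realizable_mono[OF work_single[of "\<lambda>_. a" Stay]]) (auto simp: put_def on_work_def)

lemma work_if:
  assumes "realizable (on_work T)"
  shows "realizable (on_work ({(s, s'). (s, s') \<in> T \<and> \<phi> (fst s (snd s))} \<union>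
    {(s, s'). s' = s \<and> \<not> \<phi> (fst s (snd s))}))"
  by (rule realizable_mono[OF realizable_if[OF assms, of "\<lambda>x y z. \<phi> y"]])
    (auto simp: on_work_def holds_def)

text \<open>Registers live on the negative half of the work tape: \<open>Zs\<close> at \<open>- 3 - (i * k + r)\<close> means that
  register \<open>r\<close> of \<open>k\<close> exceeds \<open>i\<close>.  The head rests on the only \<open>Os\<close> of that half, at \<open>- 2\<close>; the blank at
  \<open>- 1\<close> delimits the output on the other half.\<close>
definition reg_tape :: "nat \<Rightarrow> (nat \<Rightarrow> nat) \<Rightarrow> bool list \<Rightarrow> int \<Rightarrow> sym" where
  "reg_tape k v out p =
     (if p = - 2 then Os else if p = - 1 then Bl else if 0 \<le> p then enc1 out (nat p)
      else if nat (- 3 - p) div k < v (nat (- 3 - p) mod k) then Zs else Bl)"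

text \<open>Interleaving with stride \<open>k\<close> lets every register grow without bound while
  the others stay in place; walking along one register is a scan by \<open>- int k\<close>.\<close>

lemma reg_tape_cell:
  "r < k \<Longrightarrow> reg_tape k v out (- 3 - int r - int i * int k) = (if i < v r then Zs else Bl)"
proof -
  assume r: "r < k"
  have "nat (- 3 - (- 3 - int r - int i * int k)) = r + i * k"
    by (simp add: nat_add_distrib nat_mult_distrib)
  moreover have "(r + i * k) div k = i" "(r + i * k) mod k = r" using r by auto
  ultimately show ?thesis by (auto simp: reg_tape_def)
qed

lemma cell_cases:
  assumes "0 < k" "p \<le> - 3"
  obtains i r where "r < k" "p = - 3 - int r - int i * int k"
proof
  show "nat (- 3 - p) mod k < k" using assms by simp
  have "int (nat (- 3 - p)) = int (nat (- 3 - p) mod k) + int (nat (- 3 - p) div k) * int k"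
    by (metis mod_div_mult_eq of_nat_add of_nat_mult)
  then show "p = - 3 - int (nat (- 3 - p) mod k) - int (nat (- 3 - p) div k) * int k"
    using assms(2) by simp
qed

lemma cell_inject:
  assumes "r < k" "r' < k" "- 3 - int r - int i * int k = - 3 - int r' - int i' * int k"
  shows "r = r' \<and> i = i'"
proof -
  have "int (r + i * k) = int (r' + i' * k)" using assms(3) by simp
  then have e: "r + i * k = r' + i' * k" by linarith
  have "(r + i * k) mod k = r" "(r' + i' * k) mod k = r'"
    "(r + i * k) div k = i" "(r' + i' * k) div k = i'"
    using assms(1,2) by auto
  with e show ?thesis by metis
qed

text \<open>One statement for both directions: increment takes \<open>i = v r\<close> and
  \<open>m = v r + 1\<close>, decrement takes \<open>i = m = v r - 1\<close>.\<close>

lemma reg_tape_upd: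
  assumes "r < k" and that: "\<And>j. j \<noteq> i \<Longrightarrow> (j < v r) = (j < m)"
  shows "(reg_tape k v out)(- 3 - int r - int i * int k := (if i < m then Zs else Bl)) =
    reg_tape k (v(r := m)) out"
proof
  fix p
  show "((reg_tape k v out)(- 3 - int r - int i * int k := (if i < m then Zs else Bl))) p =
    reg_tape k (v(r := m)) out p"
  proof (cases "p \<le> - 3")
    case False
    moreover have "p \<noteq> - 3 - int r - int i * int k" using False by (smt (verit) of_nat_0_le_iff mult_nonneg_nonneg)
    ultimately show ?thesis by (auto simp: reg_tape_def)
  next
    case True
    then obtain j r' where p: "r' < k" "p = - 3 - int r' - int j * int k"
      using cell_cases assms by (metis gr_zeroI less_zeroE)
    show ?thesis
      using cell_inject[OF p(1) assms(1), of j i] that[of j]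
      by (auto simp: p(2) reg_tape_cell[OF p(1)] reg_tape_cell[OF assms(1)])
  qed
qed

definition home :: "(((int \<Rightarrow> sym) \<times> int) \<times> ((int \<Rightarrow> sym) \<times> int)) set" where
  "home = scan (\<lambda>a. a \<noteq> Os) 1"

lemma reg_tape_home: "p \<le> - 2 \<Longrightarrow> ((reg_tape k v out, p), (reg_tape k v out, - 2)) \<in> home"
  unfolding home_def
  by (rule scanI[where j = "nat (- 2 - p)"]) (auto simp: reg_tape_def)

lemma reg_tape_scan:
  assumes "r < k"
  shows "((reg_tape k v out, - 3 - int r), (reg_tape k v out, - 3 - int r - int (v r) * int k))
    \<in> scan (\<lambda>a. a = Zs) (- int k)"
proof (rule scanI[where j = "v r"])
  fix i assume "i < v r"
  have "- 3 - int r + int i * - int k = - 3 - int r - int i * int k" by simp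
  then show "reg_tape k v out (- 3 - int r + int i * - int k) = Zs"
    using reg_tape_cell[OF assms, of v out i] \<open>i < v r\<close> by simp
qed (use reg_tape_cell[OF assms, of v out "v r"] in auto)

section \<open>Register operations as functions on abstract states\<close>

type_synonym mstate = "(nat \<Rightarrow> nat) \<times> (nat \<Rightarrow> sym) \<times> (nat \<Rightarrow> sym) \<times> nat \<times> bool list"

definition emb :: "nat \<Rightarrow> mstate \<Rightarrow> tapes" where
  "emb k s = (case s of (v, inp, I, ih, out) \<Rightarrow> (inp, reg_tape k v out, - 2, I, ih))"

definition real_fun :: "nat \<Rightarrow> (mstate \<Rightarrow> bool) \<Rightarrow> (mstate \<Rightarrow> mstate) \<Rightarrow> bool" where
  "real_fun k P F \<longleftrightarrow> realizable {(emb k s, emb k (F s)) | s. P s}"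

lemma real_funI: "realizable R \<Longrightarrow> (\<And>s. P s \<Longrightarrow> (emb k s, emb k (F s)) \<in> R) \<Longrightarrow> real_fun k P F"
  unfolding real_fun_def by (erule realizable_mono) auto

lemma real_fun_weaken:
  "real_fun k P F \<Longrightarrow> (\<And>s. Q s \<Longrightarrow> P s) \<Longrightarrow> (\<And>s. Q s \<Longrightarrow> G s = F s) \<Longrightarrow> real_fun k Q G"
  by (rule real_funI, unfold real_fun_def, assumption) (simp only: mem_Collect_eq prod.inject, blast)

lemma real_fun_comp:
  assumes "real_fun k P F" "real_fun k Q G" "\<And>s. P s \<Longrightarrow> Q (F s)"
  shows "real_fun k P (\<lambda>s. G (F s))"
  by (rule real_funI[OF realizable_comp[OF assms(1,2)[unfolded real_fun_def]]])
    (use assms(3) in blast)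

lemma real_fun_inc:
  assumes "r < k"
  shows "real_fun k (\<lambda>_. True) (\<lambda>(v, x). (v(r := v r + 1), x))"
proof (rule real_funI)
  let ?T = "shift (- 1 - int r) O scan (\<lambda>a. a = Zs) (- int k) O put Zs O home"
  show "realizable (on_work ?T)"
    unfolding home_def by (intro work_comp work_shift work_scan work_put)
  fix s :: mstate
  obtain v inp I ih out where s: "s = (v, inp, I, ih, out)" by (cases s)
  let ?W = "reg_tape k v out" and ?p = "- 3 - int r - int (v r) * int k"
  have 1: "((?W, - 2), (?W, - 3 - int r)) \<in> shift (- 1 - int r)" by (auto simp: shift_def)
  note 2 = reg_tape_scan[OF assms, of v out]
  have 3: "((?W, ?p), (reg_tape k (v(r := v r + 1)) out, ?p)) \<in> put Zs"
    using reg_tape_upd[OF assms, of "v r" v "v r + 1" out] by (fastforce simp: put_def)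
  have 4: "((reg_tape k (v(r := v r + 1)) out, ?p), (reg_tape k (v(r := v r + 1)) out, - 2)) \<in> home"
    by (rule reg_tape_home) (smt (verit) of_nat_0_le_iff mult_nonneg_nonneg)
  have "((?W, - 2), (reg_tape k (v(r := v r + 1)) out, - 2)) \<in> ?T"
    by (rule relcomp.relcompI[OF 1 relcomp.relcompI[OF 2 relcomp.relcompI[OF 3 4]]])
  from on_workI[OF this, of inp I ih]
  show "(emb k s, emb k ((\<lambda>(v, x). (v(r := v r + 1), x)) s)) \<in> on_work ?T"
    by (simp only: s emb_def prod.case)
qed

lemma real_fun_dec:
  assumes "r < k"
  shows "real_fun k (\<lambda>_. True) (\<lambda>(v, x). (v(r := v r - 1), x))"
proof (rule real_funI)
  let ?S = "scan (\<lambda>a. a = Zs) (- int k) O shift (int k) O put Bl"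
  \<comment> \<open>The guard is for a register at zero: the scan would not move, and the shift by
    \<open>k\<close> would land at \<open>- 2\<close> or further right, outside the
    registers.\<close>
  let ?B = "{(s, s'). (s, s') \<in> ?S \<and> fst s (snd s) = Zs} \<union> {(s, s'). s' = s \<and> \<not> fst s (snd s) = Zs}"
  let ?T = "shift (- 1 - int r) O ?B O home"
  show "realizable (on_work ?T)"
    unfolding home_def by (intro work_comp work_shift work_scan work_put work_if)
  fix s :: mstate
  obtain v inp I ih out where s: "s = (v, inp, I, ih, out)" by (cases s)
  let ?W = "reg_tape k v out"
  let ?W' = "reg_tape k (v(r := v r - 1)) out"
  have 1: "((?W, - 2), (?W, - 3 - int r)) \<in> shift (- 1 - int r)" by (auto simp: shift_def)
  have c: "?W (- 3 - int r) = (if 0 < v r then Zs else Bl)"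
    using reg_tape_cell[OF assms, of v out 0] by simp
  have "((?W, - 2), (?W', - 2)) \<in> ?T"
  proof (cases "v r")
    case 0
    then have 2: "((?W, - 3 - int r), (?W, - 3 - int r)) \<in> ?B" using c by simp
    have 3: "((?W, - 3 - int r), (?W, - 2)) \<in> home" by (rule reg_tape_home) simp
    have "?W' = ?W" using 0 by (metis diff_0_eq_0 fun_upd_triv)
    then show ?thesis using relcomp.relcompI[OF 1 relcomp.relcompI[OF 2 3]] by simp
  next
    case (Suc m)
    let ?p = "- 3 - int r - int m * int k"
    have 2: "((?W, - 3 - int r), (?W, ?p - int k)) \<in> scan (\<lambda>a. a = Zs) (- int k)"
      using reg_tape_scan[OF assms, of v out] Suc by (simp add: algebra_simps)
    have 3: "((?W, ?p - int k), (?W, ?p)) \<in> shift (int k)" by (auto simp: shift_def)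
    have 4: "((?W, ?p), (?W', ?p)) \<in> put Bl"
      using reg_tape_upd[OF assms, of m v m out] Suc by (fastforce simp: put_def)
    have "((?W, - 3 - int r), (?W', ?p)) \<in> ?S"
      by (rule relcomp.relcompI[OF 2 relcomp.relcompI[OF 3 4]])
    then have 5: "((?W, - 3 - int r), (?W', ?p)) \<in> ?B" using c Suc by simp
    have 6: "((?W', ?p), (?W', - 2)) \<in> home"
      by (rule reg_tape_home) (smt (verit) of_nat_0_le_iff mult_nonneg_nonneg)
    show ?thesis by (rule relcomp.relcompI[OF 1 relcomp.relcompI[OF 5 6]])
  qed
  from on_workI[OF this, of inp I ih]
  show "(emb k s, emb k ((\<lambda>(v, x). (v(r := v r - 1), x)) s)) \<in> on_work ?T"
    by (simp only: s emb_def prod.case)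
qed

text \<open>The test state of the loop reads the lowest cell of register \<open>r\<close>, so each pass brackets the
  body by a return to the resting position and a new visit to that cell.\<close>
lemma real_fun_while:
  fixes \<mu> :: "mstate \<Rightarrow> nat"
  assumes r: "r < k"
    and body: "real_fun k (\<lambda>s. P s \<and> fst s r \<noteq> 0) F"
    and inv: "\<And>s. P s \<Longrightarrow> fst s r \<noteq> 0 \<Longrightarrow> P (F s) \<and> \<mu> (F s) < \<mu> s \<and> G s = G (F s)"
    and stop: "\<And>s. P s \<Longrightarrow> fst s r = 0 \<Longrightarrow> G s = s"
  shows "real_fun k P G"
proof (rule real_funI)
  define at_cell where "at_cell = (\<lambda>(v, inp, I, ih, out). (inp, reg_tape k v out, - 3 - int r, I, ih) :: tapes)"
  let ?go = "on_work (shift (- 1 - int r))" and ?h = "on_work home"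
  let ?B = "{(emb k s, emb k (F s)) | s. P s \<and> fst s r \<noteq> 0}"
  let ?\<phi> = "\<lambda>x y z. y = Zs"
  let ?L = "{(s, s'). (s, s') \<in> ?h O ?B O ?go \<and> holds ?\<phi> s}"
  let ?W = "{(s, s'). (s, s') \<in> ?L\<^sup>* \<and> \<not> holds ?\<phi> s'}"
  have h: "realizable ?h" unfolding home_def by (rule work_scan)
  show "realizable (?go O ?W O ?h)"
    by (intro realizable_comp realizable_while work_shift h body[unfolded real_fun_def])
  have go: "(emb k s, at_cell s) \<in> ?go" for s
    by (auto simp: emb_def at_cell_def shift_def split: prod.split intro!: on_workI)
  have ret: "(at_cell s, emb k s) \<in> ?h" for s
    by (auto simp: emb_def at_cell_def split: prod.split intro!: on_workI reg_tape_home)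
  have test: "holds ?\<phi> (at_cell s) \<longleftrightarrow> fst s r \<noteq> 0" for s
    using reg_tape_cell[OF r, of _ _ 0] by (auto simp: at_cell_def holds_def split: prod.split)
  have "(at_cell s, at_cell (G s)) \<in> ?W" if "P s" for s
    using that
  proof (induction "\<mu> s" arbitrary: s rule: less_induct)
    case less
    show ?case
    proof (cases "fst s r = 0")
      case True
      then show ?thesis using stop[OF less.prems] test[of s] by auto
    next
      case False
      have "(emb k s, emb k (F s)) \<in> ?B" using False less.prems by blast
      then have "(at_cell s, at_cell (F s)) \<in> ?h O ?B O ?go" using ret[of s] go[of "F s"] by blast
      then have 1: "(at_cell s, at_cell (F s)) \<in> ?L" using test[of s] False by simp
      have 2: "(at_cell (F s), at_cell (G (F s))) \<in> ?W"
        using less.hyps[of "F s"] inv[OF less.prems False] by blast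
      have "(at_cell s, at_cell (G (F s))) \<in> ?L\<^sup>*"
        by (rule converse_rtrancl_into_rtrancl[OF 1]) (use 2 in blast)
      moreover have "G s = G (F s)" using inv[OF less.prems False] by blast
      ultimately show ?thesis using 2 by simp
    qed
  qed
  then show "(emb k s, emb k (G s)) \<in> ?go O ?W O ?h" if "P s" for s
    using that go[of s] ret[of "G s"] by blast
qed

definition ext_holds :: "(sym \<Rightarrow> sym \<Rightarrow> bool) \<Rightarrow> mstate \<Rightarrow> bool" where
  "ext_holds \<phi> s = (case s of (v, inp, I, ih, out) \<Rightarrow> \<phi> (inp (addr I)) (I ih))"

text \<open>These tests see only the input and the index tape, so they can be made at the resting
  position; unlike register tests they need no trip along the work tape.\<close>

lemma holds_emb: "holds (\<lambda>x y z. \<phi> x z) (emb k s) = ext_holds \<phi> s"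
  by (auto simp: holds_def ext_holds_def emb_def split: prod.split)

lemma real_fun_ext_while:
  fixes \<mu> :: "mstate \<Rightarrow> nat"
  assumes body: "real_fun k (\<lambda>s. P s \<and> ext_holds \<phi> s) F"
    and inv: "\<And>s. P s \<Longrightarrow> ext_holds \<phi> s \<Longrightarrow> P (F s) \<and> \<mu> (F s) < \<mu> s \<and> G s = G (F s)"
    and stop: "\<And>s. P s \<Longrightarrow> \<not> ext_holds \<phi> s \<Longrightarrow> G s = s"
  shows "real_fun k P G"
proof (rule real_funI[OF realizable_while[OF body[unfolded real_fun_def], of "\<lambda>x y z. \<phi> x z"]])
  let ?B = "{(emb k s, emb k (F s)) | s. P s \<and> ext_holds \<phi> s}"
  let ?\<phi> = "\<lambda>x y z. \<phi> x z"
  let ?W = "{(s, s'). (s, s') \<in> {(s, s'). (s, s') \<in> ?B \<and> holds ?\<phi> s}\<^sup>* \<and> \<not> holds ?\<phi> s'}"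
  show "(emb k s, emb k (G s)) \<in> ?W" if "P s" for s
    using that
  proof (induction "\<mu> s" arbitrary: s rule: less_induct)
    case less
    show ?case
    proof (cases "ext_holds \<phi> s")
      case False
      then show ?thesis using stop[OF less.prems] by (simp add: holds_emb)
    next
      case True
      have "(emb k s, emb k (F s)) \<in> ?B" using True less.prems by blast
      then have 1: "(emb k s, emb k (F s)) \<in> {(s, s'). (s, s') \<in> ?B \<and> holds ?\<phi> s}"
        using True by (simp add: holds_emb)
      have 2: "(emb k (F s), emb k (G (F s))) \<in> ?W"
        using less.hyps[of "F s"] inv[OF less.prems True] by blast
      have "(emb k s, emb k (G (F s))) \<in> {(s, s'). (s, s') \<in> ?B \<and> holds ?\<phi> s}\<^sup>*"
        by (rule converse_rtrancl_into_rtrancl[OF 1]) (use 2 in blast)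
      moreover have "G s = G (F s)" using inv[OF less.prems True] by blast
      ultimately show ?thesis using 2 by simp
    qed
  qed
qed

lemma real_fun_ext_if:
  assumes body: "real_fun k (\<lambda>s. P s \<and> ext_holds \<phi> s) F"
  shows "real_fun k P (\<lambda>s. if ext_holds \<phi> s then F s else s)"
  by (rule real_funI[OF realizable_if[OF body[unfolded real_fun_def], of "\<lambda>x y z. \<phi> x z"]])
    (auto simp: holds_emb simp del: split_paired_Ex)

lemma real_fun_index:
  "real_fun k (\<lambda>_. True) (\<lambda>(v, inp, I, ih, out). (v, inp, I(ih := f (I ih)), mv_nat ih d, out))"
  by (rule real_funI[OF realizable_single[of "\<lambda>x y z. (y, Stay, f z, d)"]])
    (auto simp: emb_def single_def split: prod.split)

lemma real_fun_emit:
  "real_fun k (\<lambda>_. True) (\<lambda>(v, inp, I, ih, out). (v, inp, I, ih, out @ [b]))"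
proof (rule real_funI)
  let ?T = "shift 2 O scan (\<lambda>a. a \<noteq> Bl) 1 O put (bitsym b) O scan (\<lambda>a. a \<noteq> Bl) (- 1) O shift (- 1)"
  show "realizable (on_work ?T)" by (intro work_comp work_shift work_scan work_put)
  fix s :: mstate
  obtain v inp I ih out where s: "s = (v, inp, I, ih, out)" by (cases s)
  let ?W = "reg_tape k v out" and ?W' = "reg_tape k v (out @ [b])" and ?n = "int (length out)"
  have 1: "((?W, - 2), (?W, 0)) \<in> shift 2" by (auto simp: shift_def)
  have 2: "((?W, 0), (?W, ?n)) \<in> scan (\<lambda>a. a \<noteq> Bl) 1"
    by (rule scanI[where j = "length out"]) (auto simp: reg_tape_def enc1_def bitsym_def)
  have "?W(?n := bitsym b) = ?W'"
    by (rule ext) (auto simp: reg_tape_def enc1_def nth_append)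
  then have 3: "((?W, ?n), (?W', ?n)) \<in> put (bitsym b)" by (auto simp: put_def)
  have 4: "((?W', ?n), (?W', - 1)) \<in> scan (\<lambda>a. a \<noteq> Bl) (- 1)"
    by (rule scanI[where j = "Suc (length out)"]) (auto simp: reg_tape_def enc1_def bitsym_def)
  have 5: "((?W', - 1), (?W', - 2)) \<in> shift (- 1)" by (auto simp: shift_def)
  have "((?W, - 2), (?W', - 2)) \<in> ?T"
    by (rule relcomp.relcompI[OF 1 relcomp.relcompI[OF 2 relcomp.relcompI[OF 3 relcomp.relcompI[OF 4 5]]]])
  from on_workI[OF this, of inp I ih]
  show "(emb k s, emb k ((\<lambda>(v, inp, I, ih, out). (v, inp, I, ih, out @ [b])) s)) \<in> on_work ?T"
    by (simp only: s emb_def prod.case)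
qed

section \<open>A class of computable functions\<close>

text \<open>The number \<open>k\<close> of registers is part of the tape layout, but a program
  mentions only finitely many. Asking for all large \<open>k\<close> lets programs with different
  needs be composed before any \<open>k\<close> is fixed.\<close>

definition computes :: "(mstate \<Rightarrow> bool) \<Rightarrow> (mstate \<Rightarrow> mstate) \<Rightarrow> bool" where
  "computes P F \<longleftrightarrow> (\<forall>\<^sub>F k in sequentially. real_fun k P F)"

definition reg_prog :: "((nat \<Rightarrow> nat) \<Rightarrow> bool) \<Rightarrow> ((nat \<Rightarrow> nat) \<Rightarrow> nat \<Rightarrow> nat) \<Rightarrow> bool" where
  "reg_prog P f \<longleftrightarrow> computes (\<lambda>(v, x). P v) (\<lambda>(v, x). (f v, x))"

lemma computes_weaken:
  "computes P F \<Longrightarrow> (\<And>s. Q s \<Longrightarrow> P s) \<Longrightarrow> (\<And>s. Q s \<Longrightarrow> G s = F s) \<Longrightarrow> computes Q G"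
  unfolding computes_def by (erule eventually_mono) (rule real_fun_weaken)

lemma computes_seq:
  assumes "computes P F" "computes Q G" "\<And>s. R s \<Longrightarrow> P s \<and> Q (F s) \<and> H s = G (F s)"
  shows "computes R H"
  using assms(1,2) unfolding computes_def
proof eventually_elim
  case (elim k)
  have "real_fun k R F"
    by (rule real_fun_weaken[OF elim(1)]) (use assms(3) in blast)+
  then have "real_fun k R (\<lambda>s. G (F s))"
    by (rule real_fun_comp[OF _ elim(2)]) (use assms(3) in blast)
  then show ?case by (rule real_fun_weaken) (use assms(3) in blast)+
qed

lemma computes_while:
  fixes \<mu> :: "mstate \<Rightarrow> nat"
  assumes "computes (\<lambda>s. P s \<and> fst s r \<noteq> 0) F"
    and "\<And>s. P s \<Longrightarrow> fst s r \<noteq> 0 \<Longrightarrow> P (F s) \<and> \<mu> (F s) < \<mu> s \<and> G s = G (F s)"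
    and "\<And>s. P s \<Longrightarrow> fst s r = 0 \<Longrightarrow> G s = s"
  shows "computes P G"
  using assms(1) eventually_gt_at_top[of r] unfolding computes_def
  by eventually_elim (rule real_fun_while[OF _ _ assms(2,3)])

lemma computes_ext_while:
  fixes \<mu> :: "mstate \<Rightarrow> nat"
  assumes "computes (\<lambda>s. P s \<and> ext_holds \<phi> s) F"
    and "\<And>s. P s \<Longrightarrow> ext_holds \<phi> s \<Longrightarrow> P (F s) \<and> \<mu> (F s) < \<mu> s \<and> G s = G (F s)"
    and "\<And>s. P s \<Longrightarrow> \<not> ext_holds \<phi> s \<Longrightarrow> G s = s"
  shows "computes P G"
  using assms(1) unfolding computes_def
  by eventually_elim (rule real_fun_ext_while[OF _ assms(2,3)])

lemma computes_ext_if: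
  assumes "computes (\<lambda>s. P s \<and> ext_holds \<phi> s) F"
  shows "computes P (\<lambda>s. if ext_holds \<phi> s then F s else s)"
  using assms unfolding computes_def by eventually_elim (rule real_fun_ext_if)

lemma computes_index:
  "computes (\<lambda>_. True) (\<lambda>(v, inp, I, ih, out). (v, inp, I(ih := f (I ih)), mv_nat ih d, out))"
  unfolding computes_def by (simp only: real_fun_index eventually_True)

lemma computes_emit:
  "computes (\<lambda>_. True) (\<lambda>(v, inp, I, ih, out). (v, inp, I, ih, out @ [b]))"
  unfolding computes_def by (simp only: real_fun_emit eventually_True)

lemma prog_weaken:
  "reg_prog P f \<Longrightarrow> (\<And>v. Q v \<Longrightarrow> P v \<and> g v = f v) \<Longrightarrow> reg_prog Q g"
  unfolding reg_prog_def by (erule computes_weaken) auto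

lemma prog_seq:
  "reg_prog P f \<Longrightarrow> reg_prog Q g \<Longrightarrow> (\<And>v. R v \<Longrightarrow> P v \<and> Q (f v) \<and> h v = g (f v)) \<Longrightarrow> reg_prog R h"
  unfolding reg_prog_def by (erule computes_seq, assumption) auto

lemma prog_inc: "reg_prog (\<lambda>_. True) (\<lambda>v. v(r := v r + 1))"
  unfolding reg_prog_def computes_def
  using eventually_gt_at_top[of r]
  by eventually_elim (rule real_fun_weaken[OF real_fun_inc], auto)

lemma prog_dec: "reg_prog (\<lambda>_. True) (\<lambda>v. v(r := v r - 1))"
  unfolding reg_prog_def computes_def
  using eventually_gt_at_top[of r]
  by eventually_elim (rule real_fun_weaken[OF real_fun_dec], auto)

lemma prog_while:
  fixes \<mu> :: "(nat \<Rightarrow> nat) \<Rightarrow> nat"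
  assumes "reg_prog (\<lambda>v. P v \<and> v r \<noteq> 0) f"
    and "\<And>v. P v \<Longrightarrow> v r \<noteq> 0 \<Longrightarrow> P (f v) \<and> \<mu> (f v) < \<mu> v \<and> g v = g (f v)"
    and "\<And>v. P v \<Longrightarrow> v r = 0 \<Longrightarrow> g v = v"
  shows "reg_prog P g"
  unfolding reg_prog_def
proof (rule computes_while[where \<mu> = "\<lambda>s. \<mu> (fst s)" and r = r])
  show "computes (\<lambda>s. (case s of (v, x) \<Rightarrow> P v) \<and> fst s r \<noteq> 0) (\<lambda>(v, x). (f v, x))"
    by (rule computes_weaken[OF assms(1)[unfolded reg_prog_def]]) auto
qed (use assms(2,3) in auto)

lemma prog_zero: "reg_prog (\<lambda>_. True) (\<lambda>v. v(r := 0))"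
  by (rule prog_while[where r = r and \<mu> = "\<lambda>v. v r" and f = "\<lambda>v. v(r := v r - 1)"])
    (rule prog_weaken[OF prog_dec[of r]], auto)

lemma prog_move2:
  assumes "r \<noteq> a" "r \<noteq> b" "a \<noteq> b"
  shows "reg_prog (\<lambda>_. True) (\<lambda>v. v(a := v a + v r, b := v b + v r, r := 0))"
proof (rule prog_while[where r = r and \<mu> = "\<lambda>v. v r"])
  have h: "reg_prog (\<lambda>_. True) (\<lambda>v. v(a := v a + 1, b := v b + 1))"
    by (rule prog_seq[OF prog_inc[of a] prog_inc[of b]]) (use assms in auto)
  show "reg_prog (\<lambda>v. True \<and> v r \<noteq> 0) (\<lambda>v. v(a := v a + 1, b := v b + 1, r := v r - 1))"
    by (rule prog_seq[OF h prog_dec[of r]]) (use assms in auto)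
qed (use assms in \<open>auto simp: fun_eq_iff\<close>)

lemma prog_move:
  assumes "r \<noteq> a"
  shows "reg_prog (\<lambda>_. True) (\<lambda>v. v(a := v a + v r, r := 0))"
proof (rule prog_while[where r = r and \<mu> = "\<lambda>v. v r"])
  show "reg_prog (\<lambda>v. True \<and> v r \<noteq> 0) (\<lambda>v. v(a := v a + 1, r := v r - 1))"
    by (rule prog_seq[OF prog_inc[of a] prog_dec[of r]]) (use assms in auto)
qed (use assms in \<open>auto simp: fun_eq_iff\<close>)

lemma prog_copy:
  assumes "r \<noteq> a" "r \<noteq> t" "a \<noteq> t"
  shows "reg_prog (\<lambda>v. v t = 0) (\<lambda>v. v(a := v a + v r))"
  by (rule prog_seq[OF prog_move2[OF assms] prog_move[of t r]])
    (use assms in \<open>auto simp: fun_eq_iff\<close>)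

text \<open>The scratch convention: a computation based at \<open>r\<close> finds all registers
  above \<open>r\<close> at zero; in \<open>recfn\<close> it also leaves them so and does not change
  those below.\<close>

definition clean :: "nat \<Rightarrow> (nat \<Rightarrow> nat) \<Rightarrow> bool" where
  "clean r v \<longleftrightarrow> (\<forall>j>r. v j = 0)"

text \<open>\<open>prod_encode (m, n)\<close> is \<open>triangle (m + n) + m\<close>. The first move
  leaves \<open>m\<close> in \<open>r\<close> and \<open>m + n\<close> in \<open>r + 2\<close>;
  counting the latter down sums up the triangular number.\<close>

lemma prog_encode:
  "reg_prog (\<lambda>v. v r = 0 \<and> clean (r + 2) v)
     (\<lambda>v. v(r := prod_encode (v (r + 1), v (r + 2)), r + 1 := 0, r + 2 := 0))"
proof -
  have body: "reg_prog (\<lambda>v. v (r + 1) = 0) (\<lambda>v. v(r := v r + v (r + 2), r + 2 := v (r + 2) - 1))"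
    by (rule prog_seq[OF prog_copy[of "r + 2" r "r + 1"] prog_dec[of "r + 2"]]) auto
  have loop: "reg_prog (\<lambda>v. v (r + 1) = 0) (\<lambda>v. v(r := v r + triangle (v (r + 2)), r + 2 := 0))"
  proof (rule prog_while[where r = "r + 2" and \<mu> = "\<lambda>v. v (r + 2)"])
    show "reg_prog (\<lambda>v. v (r + 1) = 0 \<and> v (r + 2) \<noteq> 0)
      (\<lambda>v. v(r := v r + v (r + 2), r + 2 := v (r + 2) - 1))"
      by (rule prog_weaken[OF body]) auto
    fix v :: "nat \<Rightarrow> nat"
    assume v: "v (r + 1) = 0" "v (r + 2) \<noteq> 0"
    then obtain n where "v (r + 2) = Suc n" using not0_implies_Suc by blast
    with v show "(v(r := v r + v (r + 2), r + 2 := v (r + 2) - 1)) (r + 1) = 0 \<and>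
       (v(r := v r + v (r + 2), r + 2 := v (r + 2) - 1)) (r + 2) < v (r + 2) \<and>
       v(r := v r + triangle (v (r + 2)), r + 2 := 0) =
       (v(r := v r + v (r + 2), r + 2 := v (r + 2) - 1))
         (r := (v(r := v r + v (r + 2), r + 2 := v (r + 2) - 1)) r +
              triangle ((v(r := v r + v (r + 2), r + 2 := v (r + 2) - 1)) (r + 2)), r + 2 := 0)"
      by (auto simp: fun_eq_iff)
  qed (auto simp: fun_eq_iff)
  show ?thesis
    by (rule prog_seq[OF prog_move2[of "r + 1" r "r + 2"] loop])
      (auto simp: fun_eq_iff prod_encode_def add.commute)
qed

text \<open>The successor in the diagonal enumeration underlying \<open>prod_encode\<close>.\<close>
definition diag_step :: "nat \<times> nat \<Rightarrow> nat \<times> nat" where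
  "diag_step p = (if snd p = 0 then (0, fst p + 1) else (fst p + 1, snd p - 1))"

lemma prod_encode_diag_step: "prod_encode (diag_step p) = Suc (prod_encode p)"
  by (cases p; cases "snd p") (auto simp: diag_step_def prod_encode_def)

text \<open>Registers are tested by loops only, so the case distinction is made of loops with at
  most one pass: \<open>t\<close> receives \<open>v b\<close>, \<open>f\<close> receives
  \<open>1 - v b\<close>, and exactly one of them is nonzero, which selects \<open>l2\<close> or
  \<open>l3\<close>.\<close>

lemma prog_diag_step:
  assumes d: "distinct [a, b, t, f]"
  shows "reg_prog (\<lambda>v. v t = 0 \<and> v f = 0)
    (\<lambda>v. v(a := fst (diag_step (v a, v b)), b := snd (diag_step (v a, v b))))"
proof -
  have l1: "reg_prog (\<lambda>_. True) (\<lambda>v. v(t := v t + v b, f := v f - v b, b := 0))"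
  proof (rule prog_while[where r = b and \<mu> = "\<lambda>v. v b"])
    have h: "reg_prog (\<lambda>_. True) (\<lambda>v. v(t := v t + 1, f := v f - 1))"
      by (rule prog_seq[OF prog_inc[of t] prog_dec[of f]]) (use d in auto)
    show "reg_prog (\<lambda>v. True \<and> v b \<noteq> 0) (\<lambda>v. v(t := v t + 1, f := v f - 1, b := v b - 1))"
      by (rule prog_seq[OF h prog_dec[of b]]) (use d in auto)
  qed (use d in \<open>auto simp: fun_eq_iff\<close>)
  have l2: "reg_prog (\<lambda>_. True)
    (\<lambda>v. if v t = 0 then v else v(b := v b + v t - 1, a := v a + 1, t := 0))"
  proof (rule prog_while[where r = t and \<mu> = "\<lambda>v. v t"])
    have h: "reg_prog (\<lambda>_. True) (\<lambda>v. v(b := v b + v t - 1, t := 0))"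
      by (rule prog_seq[OF prog_move[of t b] prog_dec[of b]]) (use d in \<open>auto simp: fun_eq_iff\<close>)
    show "reg_prog (\<lambda>v. True \<and> v t \<noteq> 0) (\<lambda>v. v(b := v b + v t - 1, a := v a + 1, t := 0))"
      by (rule prog_seq[OF h prog_inc[of a]]) (use d in \<open>auto simp: fun_eq_iff\<close>)
  qed (use d in \<open>auto simp: fun_eq_iff\<close>)
  have l3: "reg_prog (\<lambda>v. v f \<le> 1)
    (\<lambda>v. if v f = 0 then v else v(b := v b + v a + 1, a := 0, f := 0))"
  proof (rule prog_while[where r = f and \<mu> = "\<lambda>v. v f"])
    have h: "reg_prog (\<lambda>_. True) (\<lambda>v. v(b := v b + v a + 1, a := 0))"
      by (rule prog_seq[OF prog_move[of a b] prog_inc[of b]]) (use d in \<open>auto simp: fun_eq_iff\<close>)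
    show "reg_prog (\<lambda>v. v f \<le> 1 \<and> v f \<noteq> 0) (\<lambda>v. v(b := v b + v a + 1, a := 0, f := v f - 1))"
      by (rule prog_seq[OF h prog_dec[of f]]) (use d in \<open>auto simp: fun_eq_iff\<close>)
  qed (use d in \<open>auto simp: fun_eq_iff\<close>)
  have s1: "reg_prog (\<lambda>_. True) (\<lambda>v. v(f := v f + 1 - v b, t := v t + v b, b := 0))"
    by (rule prog_seq[OF prog_inc[of f] l1]) (use d in \<open>auto simp: fun_eq_iff\<close>)
  have s2: "reg_prog (\<lambda>v. v t = 0) (\<lambda>v. if v b = 0 then v(f := v f + 1)
     else v(f := v f + 1 - v b, b := v b - 1, a := v a + 1))"
    by (rule prog_seq[OF s1 l2]) (use d in \<open>auto simp: fun_eq_iff\<close>)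
  show ?thesis
    by (rule prog_seq[OF s2 l3])
      (use d in \<open>auto simp: fun_eq_iff diag_step_def\<close>)
qed

text \<open>Since \<open>diag_step\<close> is the successor under \<open>prod_encode\<close>,
  \<open>v r\<close> steps from \<open>(0, 0)\<close>, the pair with code 0, arrive at
  \<open>prod_decode (v r)\<close>. The loop is stated for an arbitrary starting pair to make it
  inductive.\<close>

lemma prog_decode:
  "reg_prog (clean r) (\<lambda>v. v(r := 0, r + 1 := fst (prod_decode (v r)), r + 2 := snd (prod_decode (v r))))"
proof -
  let ?st = "\<lambda>v::nat \<Rightarrow> nat. diag_step (v (r + 1), v (r + 2))"
  let ?f = "\<lambda>v. v(r := v r - 1, r + 1 := fst (?st v), r + 2 := snd (?st v))"
  let ?p = "\<lambda>v::nat \<Rightarrow> nat. prod_decode (prod_encode (v (r + 1), v (r + 2)) + v r)"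
  have body: "reg_prog (\<lambda>v. v (r + 3) = 0 \<and> v (r + 4) = 0) ?f"
    by (rule prog_seq[OF prog_diag_step[of "r + 1" "r + 2" "r + 3" "r + 4"] prog_dec[of r]])
      (auto simp: fun_eq_iff)
  have loop: "reg_prog (\<lambda>v. v (r + 3) = 0 \<and> v (r + 4) = 0)
    (\<lambda>v. v(r := 0, r + 1 := fst (?p v), r + 2 := snd (?p v)))"
  proof (rule prog_while[where r = r and \<mu> = "\<lambda>v. v r"])
    show "reg_prog (\<lambda>v. (v (r + 3) = 0 \<and> v (r + 4) = 0) \<and> v r \<noteq> 0) ?f"
      by (rule prog_weaken[OF body]) auto
    fix v :: "nat \<Rightarrow> nat" assume "v (r + 3) = 0 \<and> v (r + 4) = 0" "v r \<noteq> 0"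
    moreover have "?p (?f v) = ?p v"
      using prod_encode_diag_step[of "(v (r + 1), v (r + 2))"] \<open>v r \<noteq> 0\<close> by simp
    ultimately show "((?f v) (r + 3) = 0 \<and> (?f v) (r + 4) = 0) \<and> (?f v) r < v r \<and>
      v(r := 0, r + 1 := fst (?p v), r + 2 := snd (?p v)) =
      (?f v)(r := 0, r + 1 := fst (?p (?f v)), r + 2 := snd (?p (?f v)))"
      by (simp only:) (auto simp: fun_eq_iff)
  qed (auto simp: fun_eq_iff)
  have "prod_encode (0, 0) = 0" by (simp add: prod_encode_def)
  then show ?thesis
    by (intro prog_weaken[OF loop]) (auto simp: clean_def fun_eq_iff)
qed

section \<open>Relocatable computations and their closure under pairing, iteration and
  search\<close>

text \<open>Relocatability (any base register \<open>r\<close>) is what allows the closure rules to stack computations.\<close>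
definition recfn :: "(nat \<Rightarrow> nat) \<Rightarrow> bool" where
  "recfn f \<longleftrightarrow> (\<forall>r. reg_prog (clean r) (\<lambda>v. v(r := f (v r))))"

abbreviation pfst :: "nat \<Rightarrow> nat" where "pfst z \<equiv> fst (prod_decode z)"
abbreviation psnd :: "nat \<Rightarrow> nat" where "psnd z \<equiv> snd (prod_decode z)"

lemma recfn_prog: "recfn f \<Longrightarrow> reg_prog (clean r) (\<lambda>v. v(r := f (v r)))"
  unfolding recfn_def by blast

lemma recfn_Suc: "recfn Suc"
  unfolding recfn_def
proof
  show "reg_prog (clean r) (\<lambda>v. v(r := Suc (v r)))" for r
    by (rule prog_weaken[OF prog_inc[of r]]) auto
qed

lemma recfn_pred: "recfn (\<lambda>x. x - 1)"
  unfolding recfn_def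
proof
  show "reg_prog (clean r) (\<lambda>v. v(r := v r - 1))" for r
    by (rule prog_weaken[OF prog_dec[of r]]) auto
qed

lemma recfn_zero: "recfn (\<lambda>x. 0)"
  unfolding recfn_def
proof
  show "reg_prog (clean r) (\<lambda>v. v(r := 0))" for r
    by (rule prog_weaken[OF prog_zero[of r]]) auto
qed

lemma recfn_comp:
  assumes "recfn f" "recfn g"
  shows "recfn (\<lambda>x. f (g x))"
  unfolding recfn_def
proof
  show "reg_prog (clean r) (\<lambda>v. v(r := f (g (v r))))" for r
    by (rule prog_seq[OF recfn_prog[OF assms(2), of r] recfn_prog[OF assms(1), of r]])
      (auto simp: clean_def)
qed

lemma recfn_const: "recfn (\<lambda>x. n)"
proof (induction n)
  case (Suc n)
  show ?case by (rule recfn_comp[OF recfn_Suc Suc])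
qed (rule recfn_zero)

lemma recfn_id: "recfn (\<lambda>x. x)"
  unfolding recfn_def
proof
  show "reg_prog (clean r) (\<lambda>v. v(r := v r))" for r
    by (rule prog_seq[OF prog_inc[of r] prog_dec[of r]]) auto
qed

lemma recfn_pair:
  assumes "recfn f" "recfn g"
  shows "recfn (\<lambda>x. prod_encode (f x, g x))"
  unfolding recfn_def
proof
  fix r :: nat
  have 1: "reg_prog (clean r) (\<lambda>v. v(r + 1 := v r))"
    by (rule prog_weaken[OF prog_copy[of r "r + 1" "r + 2"]]) (auto simp: clean_def)
  have 2: "reg_prog (clean r) (\<lambda>v. v(r + 1 := f (v r)))"
    by (rule prog_seq[OF 1 recfn_prog[OF assms(1), of "r + 1"]]) (auto simp: clean_def)
  have 3: "reg_prog (clean r) (\<lambda>v. v(r + 1 := f (v r), r + 2 := v r))"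
    by (rule prog_seq[OF 2 prog_copy[of r "r + 2" "r + 3"]]) (auto simp: clean_def)
  have 4: "reg_prog (clean r) (\<lambda>v. v(r + 1 := f (v r), r + 2 := g (v r)))"
    by (rule prog_seq[OF 3 recfn_prog[OF assms(2), of "r + 2"]]) (auto simp: clean_def)
  have 5: "reg_prog (clean r) (\<lambda>v. v(r + 1 := f (v r), r + 2 := g (v r), r := 0))"
    by (rule prog_seq[OF 4 prog_zero[of r]]) auto
  show "reg_prog (clean r) (\<lambda>v. v(r := prod_encode (f (v r), g (v r))))"
    by (rule prog_seq[OF 5 prog_encode[of r]]) (auto simp: clean_def fun_eq_iff)
qed

lemma recfn_pfst: "recfn pfst"
  unfolding recfn_def
proof
  fix r :: nat
  have 1: "reg_prog (clean r) (\<lambda>v. v(r := 0, r + 1 := pfst (v r)))"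
    by (rule prog_seq[OF prog_decode[of r] prog_zero[of "r + 2"]]) (auto simp: clean_def fun_eq_iff)
  show "reg_prog (clean r) (\<lambda>v. v(r := pfst (v r)))"
    by (rule prog_seq[OF 1 prog_move[of "r + 1" r]]) (auto simp: clean_def fun_eq_iff)
qed

lemma recfn_psnd: "recfn psnd"
  unfolding recfn_def
proof
  fix r :: nat
  have 1: "reg_prog (clean r) (\<lambda>v. v(r := 0, r + 2 := psnd (v r)))"
    by (rule prog_seq[OF prog_decode[of r] prog_zero[of "r + 1"]]) (auto simp: clean_def fun_eq_iff)
  show "reg_prog (clean r) (\<lambda>v. v(r := psnd (v r)))"
    by (rule prog_seq[OF 1 prog_move[of "r + 2" r]]) (auto simp: clean_def fun_eq_iff)
qed

lemma recfn_iterate: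
  assumes "recfn f"
  shows "recfn (\<lambda>z. (f ^^ pfst z) (psnd z))"
  unfolding recfn_def
proof
  fix r :: nat
  let ?g = "\<lambda>v. v(r + 1 := 0, r + 2 := (f ^^ v (r + 1)) (v (r + 2)))"
  have loop: "reg_prog (clean (r + 2)) ?g"
  proof (rule prog_while[where r = "r + 1" and \<mu> = "\<lambda>v. v (r + 1)"])
    show "reg_prog (\<lambda>v. clean (r + 2) v \<and> v (r + 1) \<noteq> 0)
      (\<lambda>v. v(r + 2 := f (v (r + 2)), r + 1 := v (r + 1) - 1))"
      by (rule prog_seq[OF recfn_prog[OF assms, of "r + 2"] prog_dec[of "r + 1"]])
        (auto simp: fun_eq_iff)
    fix v assume v: "clean (r + 2) v" "v (r + 1) \<noteq> 0"
    then obtain n where "v (r + 1) = Suc n" using not0_implies_Suc by blast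
    with v show "clean (r + 2) (v(r + 2 := f (v (r + 2)), r + 1 := v (r + 1) - 1)) \<and>
      (v(r + 2 := f (v (r + 2)), r + 1 := v (r + 1) - 1)) (r + 1) < v (r + 1) \<and>
      ?g v = ?g (v(r + 2 := f (v (r + 2)), r + 1 := v (r + 1) - 1))"
      by (auto simp: fun_eq_iff clean_def funpow_swap1)
  qed (auto simp: fun_eq_iff)
  have 1: "reg_prog (clean r) (\<lambda>v. v(r := 0, r + 2 := (f ^^ pfst (v r)) (psnd (v r))))"
    by (rule prog_seq[OF prog_decode[of r] loop]) (auto simp: clean_def fun_eq_iff)
  show "reg_prog (clean r) (\<lambda>v. v(r := (f ^^ pfst (v r)) (psnd (v r))))"
    by (rule prog_seq[OF 1 prog_move[of "r + 2" r]]) (auto simp: clean_def fun_eq_iff)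
qed

lemma recfn_search:
  assumes f: "recfn f" and total: "\<And>x. \<exists>y. f (prod_encode (x, y)) = 0"
  shows "recfn (\<lambda>x. LEAST y. f (prod_encode (x, y)) = 0)"
  unfolding recfn_def
proof
  fix r :: nat
  let ?c = "\<lambda>v. f (prod_encode (v r, v (r + 1)))"
  let ?L = "\<lambda>x. LEAST y. f (prod_encode (x, y)) = 0"
  \<comment> \<open>Register \<open>r + 2\<close> always holds the test value of the current
    candidate in \<open>r + 1\<close>, so the loop test on \<open>r + 2\<close> is the test of the
    search; candidates never pass the least solution.\<close>
  let ?P = "\<lambda>v. clean (r + 2) v \<and> v (r + 2) = ?c v \<and> v (r + 1) \<le> ?L (v r)"
  have 1: "reg_prog (clean (r + 1)) (\<lambda>v. v(r + 3 := v r))"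
    by (rule prog_weaken[OF prog_copy[of r "r + 3" "r + 5"]]) (auto simp: clean_def)
  have 2: "reg_prog (clean (r + 1)) (\<lambda>v. v(r + 3 := v r, r + 4 := v (r + 1)))"
    by (rule prog_seq[OF 1 prog_copy[of "r + 1" "r + 4" "r + 5"]]) (auto simp: clean_def)
  have 3: "reg_prog (clean (r + 1)) (\<lambda>v. v(r + 2 := prod_encode (v r, v (r + 1))))"
    by (rule prog_seq[OF 2 prog_encode[of "r + 2"]]) (auto simp: clean_def fun_eq_iff eval_nat_numeral)
  have compute: "reg_prog (clean (r + 1)) (\<lambda>v. v(r + 2 := ?c v))"
    by (rule prog_seq[OF 3 recfn_prog[OF f, of "r + 2"]]) (auto simp: clean_def)
  have 4: "reg_prog (clean (r + 2)) (\<lambda>v. v(r + 2 := 0, r + 1 := v (r + 1) + 1))"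
    by (rule prog_seq[OF prog_zero[of "r + 2"] prog_inc[of "r + 1"]])
      (auto simp: fun_eq_iff)
  let ?b = "\<lambda>v. v(r + 1 := v (r + 1) + 1, r + 2 := f (prod_encode (v r, v (r + 1) + 1)))"
  have body: "reg_prog (clean (r + 2)) ?b"
    by (rule prog_seq[OF 4 compute]) (auto simp: clean_def fun_eq_iff)
  have loop: "reg_prog ?P (\<lambda>v. v(r + 1 := ?L (v r), r + 2 := 0))"
  proof (rule prog_while[where r = "r + 2" and \<mu> = "\<lambda>v. ?L (v r) - v (r + 1)"])
    show "reg_prog (\<lambda>v. ?P v \<and> v (r + 2) \<noteq> 0) ?b"
      by (rule prog_weaken[OF body]) auto
  next
    fix v assume v: "?P v" "v (r + 2) \<noteq> 0"
    have "f (prod_encode (v r, ?L (v r))) = 0" by (rule LeastI_ex) (rule total)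
    then have "v (r + 1) \<noteq> ?L (v r)" using v by metis
    then have "v (r + 1) < ?L (v r)" using v by simp
    then show "?P (?b v) \<and> ?L (?b v r) - ?b v (r + 1) < ?L (v r) - v (r + 1) \<and>
      v(r + 1 := ?L (v r), r + 2 := 0) = (?b v)(r + 1 := ?L (?b v r), r + 2 := 0)"
      using v by (auto simp: clean_def fun_eq_iff)
  next
    fix v assume v: "?P v" "v (r + 2) = 0"
    then have "?L (v r) \<le> v (r + 1)" by (intro Least_le) auto
    then show "v(r + 1 := ?L (v r), r + 2 := 0) = v" using v by (auto simp: fun_eq_iff)
  qed
  have 5: "reg_prog (clean r) (\<lambda>v. v(r + 1 := ?L (v r)))"
    by (rule prog_seq[OF compute loop]) (auto simp: clean_def fun_eq_iff)
  have 6: "reg_prog (clean r) (\<lambda>v. v(r + 1 := ?L (v r), r := 0))"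
    by (rule prog_seq[OF 5 prog_zero[of r]]) auto
  show "reg_prog (clean r) (\<lambda>v. v(r := LEAST y. f (prod_encode (v r, y)) = 0))"
    by (rule prog_seq[OF 6 prog_move[of "r + 1" r]]) (auto simp: clean_def fun_eq_iff)
qed

section \<open>Arithmetic from iteration\<close>

lemma recfn_app2:
  "recfn (\<lambda>z. F (pfst z) (psnd z)) \<Longrightarrow> recfn a \<Longrightarrow> recfn b \<Longrightarrow> recfn (\<lambda>z. F (a z) (b z))"
  using recfn_comp[of "\<lambda>z. F (pfst z) (psnd z)" "\<lambda>x. prod_encode (a x, b x)"] recfn_pair[of a b]
  by simp

lemma recfn_fst: "recfn a \<Longrightarrow> recfn (\<lambda>z. pfst (a z))"
  by (rule recfn_comp[OF recfn_pfst])

lemma recfn_snd: "recfn a \<Longrightarrow> recfn (\<lambda>z. psnd (a z))"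
  by (rule recfn_comp[OF recfn_psnd])

text \<open>\<open>recfn_iterate\<close> repeats one fixed function. A parameter \<open>z\<close>
  becomes possible by carrying it along, unchanged, as the first component of the iterated
  pair.\<close>

lemma recfn_funpow:
  assumes "recfn (\<lambda>w. F (pfst w) (psnd w))" "recfn n" "recfn y"
  shows "recfn (\<lambda>z. (F z ^^ n z) (y z))"
proof -
  let ?G = "\<lambda>p. prod_encode (pfst p, F (pfst p) (psnd p))"
  have *: "(?G ^^ m) (prod_encode (z, y)) = prod_encode (z, (F z ^^ m) y)" for m z y
    by (induction m) simp_all
  have "recfn (\<lambda>z. (?G ^^ pfst z) (psnd z))"
    by (intro recfn_iterate recfn_pair recfn_pfst assms(1))
  then have "recfn (\<lambda>z. (?G ^^ n z) (prod_encode (z, y z)))"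
    by (rule recfn_app2[where F = "\<lambda>m. ?G ^^ m"]) (intro assms(2,3) recfn_pair recfn_id)+
  then have "recfn (\<lambda>z. psnd ((?G ^^ n z) (prod_encode (z, y z))))"
    by (rule recfn_snd)
  then show ?thesis by (simp add: *)
qed

lemma recfn_add:
  assumes "recfn a" "recfn b"
  shows "recfn (\<lambda>z. a z + b z)"
proof -
  have "recfn (\<lambda>z. (Suc ^^ b z) (a z))"
    by (rule recfn_funpow[where F = "\<lambda>_. Suc"]) (intro assms recfn_comp[OF recfn_Suc] recfn_psnd)+
  then show ?thesis by (simp add: Suc_funpow add.commute)
qed

lemma recfn_diff:
  assumes "recfn a" "recfn b"
  shows "recfn (\<lambda>z. a z - b z)"
proof -
  have "recfn (\<lambda>z. ((\<lambda>x. x - 1) ^^ b z) (a z))"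
    by (rule recfn_funpow[where F = "\<lambda>_ x. x - 1"]) (intro assms recfn_comp[OF recfn_pred] recfn_psnd)+
  moreover have "((\<lambda>x. x - 1) ^^ n) m = m - n" for n m :: nat
    by (induction n) simp_all
  ultimately show ?thesis by simp
qed

lemma recfn_mult:
  assumes "recfn a" "recfn b"
  shows "recfn (\<lambda>z. a z * b z)"
proof -
  have "recfn (\<lambda>z. ((\<lambda>y. y + a z) ^^ b z) 0)"
    by (rule recfn_funpow[where F = "\<lambda>z y. y + a z"])
      (intro assms recfn_add recfn_comp[OF assms(1)] recfn_psnd recfn_pfst recfn_const)+
  moreover have "((\<lambda>y. y + m) ^^ n) 0 = m * n" for n m :: nat
    by (induction n) simp_all
  ultimately show ?thesis by simp
qed

lemma recfn_power:
  assumes "recfn a" "recfn b"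
  shows "recfn (\<lambda>z. a z ^ b z)"
proof -
  have "recfn (\<lambda>z. ((\<lambda>y. y * a z) ^^ b z) 1)"
    by (rule recfn_funpow[where F = "\<lambda>z y. y * a z"])
      (intro assms recfn_mult recfn_comp[OF assms(1)] recfn_psnd recfn_pfst recfn_const)+
  moreover have "((\<lambda>y. y * m) ^^ n) 1 = m ^ n" for n m :: nat
    by (induction n) (simp_all add: mult.commute)
  ultimately show ?thesis by simp
qed

text \<open>A conditional is the iteration of a constant function: no pass keeps \<open>a z\<close>,
  any positive number of passes gives \<open>b z\<close>.\<close>

lemma recfn_if_zero:
  assumes "recfn a" "recfn b" "recfn c"
  shows "recfn (\<lambda>z. if c z = 0 then a z else b z)"
proof -
  have "recfn (\<lambda>z. ((\<lambda>y. b z) ^^ c z) (a z))"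
    by (rule recfn_funpow[where F = "\<lambda>z y. b z"])
      (intro assms recfn_comp[OF assms(2)] recfn_pfst)+
  moreover have "((\<lambda>y. q) ^^ n) p = (if n = 0 then p else q)" for n p q :: nat
    by (induction n) simp_all
  ultimately show ?thesis by simp
qed

text \<open>Truth is 0 because unbounded search looks for a zero; this gives
  \<open>recfn_Least\<close> directly.\<close>

definition decp :: "(nat \<Rightarrow> bool) \<Rightarrow> bool" where
  "decp P \<longleftrightarrow> recfn (\<lambda>z. if P z then 0 else 1)"

lemma recfn_if:
  assumes "decp P" "recfn a" "recfn b"
  shows "recfn (\<lambda>z. if P z then a z else b z)"
proof -
  have "recfn (\<lambda>z. if (if P z then 0 else 1) = (0::nat) then a z else b z)"
    by (intro recfn_if_zero assms(2,3) assms(1)[unfolded decp_def])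
  moreover have "(\<lambda>z. if (if P z then 0 else 1) = (0::nat) then a z else b z) =
      (\<lambda>z. if P z then a z else b z)" by auto
  ultimately show ?thesis by (simp only:)
qed

lemma decp_zero: "recfn a \<Longrightarrow> decp (\<lambda>z. a z = 0)"
  unfolding decp_def by (intro recfn_if_zero recfn_const)

lemma decp_le: "recfn a \<Longrightarrow> recfn b \<Longrightarrow> decp (\<lambda>z. a z \<le> b z)"
  using decp_zero[OF recfn_diff[of a b]] by simp

lemma decp_not:
  assumes "decp P"
  shows "decp (\<lambda>z. \<not> P z)"
proof -
  have "recfn (\<lambda>z. if P z then 1 else 0)" by (intro recfn_if assms recfn_const)
  moreover have "(\<lambda>z. if P z then 1 else 0) = (\<lambda>z. if \<not> P z then 0 else 1 :: nat)" by auto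
  ultimately show ?thesis unfolding decp_def by metis
qed

lemma decp_less: "recfn a \<Longrightarrow> recfn b \<Longrightarrow> decp (\<lambda>z. a z < b z)"
  unfolding not_le[symmetric] by (intro decp_not decp_le)

lemma decp_and:
  assumes "decp P" "decp Q"
  shows "decp (\<lambda>z. P z \<and> Q z)"
proof -
  have "recfn (\<lambda>z. if P z then (if Q z then 0 else 1) else 1)"
    by (intro recfn_if assms(1) assms(2)[unfolded decp_def] recfn_const)
  moreover have "(\<lambda>z. if P z then (if Q z then 0 else 1) else 1) =
      (\<lambda>z. if P z \<and> Q z then 0 else 1 :: nat)" by auto
  ultimately show ?thesis unfolding decp_def by metis
qed

lemma decp_or: "decp P \<Longrightarrow> decp Q \<Longrightarrow> decp (\<lambda>z. P z \<or> Q z)"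
  using decp_not[of "\<lambda>z. \<not> P z \<and> \<not> Q z"] decp_and[OF decp_not[of P] decp_not[of Q]] by simp

lemma decp_imp: "decp P \<Longrightarrow> decp Q \<Longrightarrow> decp (\<lambda>z. P z \<longrightarrow> Q z)"
  unfolding imp_conv_disj by (intro decp_or decp_not)

lemma decp_eq: "recfn a \<Longrightarrow> recfn b \<Longrightarrow> decp (\<lambda>z. a z = b z)"
  unfolding eq_iff by (intro decp_and decp_le)

lemma recfn_Least:
  assumes "decp (\<lambda>w. P (pfst w) (psnd w))" and "\<And>z. \<exists>y. P z y"
  shows "recfn (\<lambda>z. LEAST y. P z y)"
proof -
  have *: "((if Q then 0 else 1 :: nat) = 0) = Q" for Q by simp
  show ?thesis
    using recfn_search[OF assms(1)[unfolded decp_def]] assms(2)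
    unfolding prod_encode_inverse fst_conv snd_conv * by blast
qed

text \<open>The search for the first counterexample is made total by letting it stop at the bound;
  the quantifier holds exactly if it gets that far.\<close>

lemma decp_ball:
  assumes "recfn n" and P: "decp (\<lambda>w. P (pfst w) (psnd w))"
  shows "decp (\<lambda>z. \<forall>i<n z. P z i)"
proof -
  let ?L = "\<lambda>z. LEAST i. n z \<le> i \<or> \<not> P z i"
  have "recfn ?L"
  proof (rule recfn_Least)
    show "decp (\<lambda>w. n (pfst w) \<le> psnd w \<or> \<not> P (pfst w) (psnd w))"
      by (intro decp_or decp_le decp_not P recfn_comp[OF assms(1)] recfn_pfst recfn_psnd)
  qed blast
  then have "decp (\<lambda>z. n z \<le> ?L z)" by (intro decp_le assms(1))
  moreover have "n z \<le> ?L z \<longleftrightarrow> (\<forall>i<n z. P z i)" for z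
  proof -
    define l where "l = ?L z"
    have 1: "n z \<le> l \<or> \<not> P z l" unfolding l_def by (rule LeastI_ex) blast
    have 2: "P z i" if "i < l" for i using not_less_Least[OF that[unfolded l_def]] by simp
    have "n z \<le> l \<longleftrightarrow> (\<forall>i<n z. P z i)"
    proof
      show "\<forall>i<n z. P z i" if "n z \<le> l" using 2 that by simp
      show "n z \<le> l" if "\<forall>i<n z. P z i"
      proof (rule ccontr)
        assume "\<not> n z \<le> l"
        with 1 that show False by simp
      qed
    qed
    then show ?thesis unfolding l_def .
  qed
  ultimately show ?thesis by simp
qed

lemma decp_bex:
  assumes "recfn n" and "decp (\<lambda>w. P (pfst w) (psnd w))"
  shows "decp (\<lambda>z. \<exists>i<n z. P z i)"
proof -
  have "decp (\<lambda>z. \<not> (\<forall>i<n z. \<not> P z i))"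
    by (rule decp_not[OF decp_ball[OF assms(1) decp_not[OF assms(2)]]])
  then show ?thesis by simp
qed

lemma recfn_sum:
  assumes f: "recfn (\<lambda>w. f (pfst w) (psnd w))" and n: "recfn n"
  shows "recfn (\<lambda>z. \<Sum>i<n z. f z i)"
proof -
  let ?F = "\<lambda>z y. prod_encode (pfst y + 1, psnd y + f z (pfst y))"
  have "recfn (\<lambda>z. (?F z ^^ n z) (prod_encode (0, 0)))"
    by (rule recfn_funpow)
      (intro n recfn_const recfn_pair recfn_add recfn_fst recfn_snd recfn_id recfn_app2[OF f])+
  then have "recfn (\<lambda>z. psnd ((?F z ^^ n z) (prod_encode (0, 0))))" by (rule recfn_snd)
  moreover have "(?F z ^^ m) (prod_encode (0, 0)) = prod_encode (m, \<Sum>i<m. f z i)" for z m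
    by (induction m) simp_all
  ultimately show ?thesis by simp
qed

lemma recfn_div:
  assumes "recfn a" "recfn b"
  shows "recfn (\<lambda>z. a z div b z)"
proof -
  \<comment> \<open>The disjunct \<open>b z = 0\<close> makes the search total and yields 0, the
    value of division by zero.\<close>
  have "recfn (\<lambda>z. LEAST q. b z = 0 \<or> a z < (q + 1) * b z)"
  proof (rule recfn_Least)
    show "decp (\<lambda>w. b (pfst w) = 0 \<or> a (pfst w) < (psnd w + 1) * b (pfst w))"
      by (intro decp_or decp_less decp_eq recfn_mult recfn_add recfn_comp[OF assms(1)]
        recfn_comp[OF assms(2)] recfn_pfst recfn_psnd recfn_const)
    show "\<exists>q. b z = 0 \<or> a z < (q + 1) * b z" for z
      by (metis One_nat_def add.commute dividend_less_times_div gr0I mult.commute mult_Suc plus_1_eq_Suc)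
  qed
  moreover have "(LEAST q. y = 0 \<or> x < (q + 1) * y) = x div y" for x y :: nat
  proof (cases "y = 0")
    case False
    then have "0 < y" by simp
    show ?thesis
    proof (rule Least_equality)
      show "y = 0 \<or> x < (x div y + 1) * y"
        using dividend_less_div_times[OF \<open>0 < y\<close>, of x] by (simp add: add.commute)
      fix q assume "y = 0 \<or> x < (q + 1) * y"
      then have "x div y < q + 1" using \<open>0 < y\<close> by (simp add: div_less_iff_less_mult)
      then show "x div y \<le> q" by simp
    qed
  qed simp
  ultimately show ?thesis by simp
qed

lemma recfn_mod: "recfn a \<Longrightarrow> recfn b \<Longrightarrow> recfn (\<lambda>z. a z mod b z)"
  unfolding minus_div_mult_eq_mod[symmetric] by (intro recfn_diff recfn_mult recfn_div)

lemma decp_bit: "recfn a \<Longrightarrow> recfn b \<Longrightarrow> decp (\<lambda>z. bit (a z) (b z))"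
  unfolding bit_iff_odd odd_iff_mod_2_eq_one
  by (intro decp_eq recfn_mod recfn_div recfn_power recfn_const)

lemmas recfn_rules = recfn_const recfn_id recfn_pair recfn_fst recfn_snd recfn_add recfn_diff
  recfn_mult recfn_power recfn_div recfn_mod recfn_if
  decp_and decp_or decp_imp decp_not decp_le decp_less decp_eq decp_bit

section \<open>Words as positive numbers, and writing them out\<close>

fun code :: "bool list \<Rightarrow> nat" where
  "code [] = 1"
| "code (b # x) = 2 * code x + of_bool b"

text \<open>The top bit 1 of a code is an end mark, which keeps words apart that differ only in
  trailing zeros. Every positive number is the code of one word; 0 is not a code and is sent to the
  empty word.\<close>

fun decode :: "nat \<Rightarrow> bool list" where
  "decode v = (if v \<le> 1 then [] else odd v # decode (v div 2))"

declare decode.simps [simp del]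

lemma code_pos: "0 < code x"
  by (induction x) auto

lemma decode_code: "decode (code x) = x"
proof (induction x)
  case (Cons b x)
  then show ?case using code_pos[of x] by (subst decode.simps) auto
qed (subst decode.simps, simp)

lemma computes_reg_prog: "reg_prog P f \<Longrightarrow> computes (\<lambda>(v, x). P v) (\<lambda>(v, x). (f v, x))"
  unfolding reg_prog_def .

lemma prog_parity: "reg_prog (clean 1) (\<lambda>v. v(2 := v 0 mod 2, 3 := 1 - v 0 mod 2))"
proof -
  have 1: "reg_prog (clean 1) (\<lambda>v. v(2 := v 0))"
    by (rule prog_weaken[OF prog_copy[of 0 2 3]]) (auto simp: clean_def)
  have 2: "reg_prog (clean 1) (\<lambda>v. v(2 := v 0 mod 2))"
    by (rule prog_seq[OF 1 recfn_prog[of "\<lambda>x. x mod 2" 2]])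
      (intro recfn_rules, auto simp: clean_def)
  have 3: "reg_prog (clean 1) (\<lambda>v. v(2 := v 0 mod 2, 3 := v 0 mod 2))"
    by (rule prog_seq[OF 2 prog_copy[of 2 3 4]]) (auto simp: clean_def)
  show ?thesis
    by (rule prog_seq[OF 3 recfn_prog[of "\<lambda>x. 1 - x" 3]])
      (intro recfn_rules, auto simp: clean_def)
qed

lemma prog_halve: "reg_prog (clean 1) (\<lambda>v. v(0 := v 0 div 2, 1 := v 0 div 2 - 1))"
proof -
  have 1: "reg_prog (clean 1) (\<lambda>v. v(1 := 0, 0 := v 0 div 2))"
    by (rule prog_seq[OF prog_zero[of 1] recfn_prog[of "\<lambda>x. x div 2" 0]])
      (intro recfn_rules, auto simp: clean_def)
  have 2: "reg_prog (clean 1) (\<lambda>v. v(0 := v 0 div 2, 1 := v 0 div 2))"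
    by (rule prog_seq[OF 1 prog_copy[of 0 1 2]]) (auto simp: clean_def)
  show ?thesis
    by (rule prog_seq[OF 2 prog_dec[of 1]]) auto
qed

lemma computes_emit_if:
  "computes (\<lambda>(v, x). v r \<le> 1) (\<lambda>(v, inp, I, ih, out).
    (v(r := 0), inp, I, ih, out @ (if v r = 1 then [b] else [])))"
proof (rule computes_while[where r = r and \<mu> = "\<lambda>s. fst s r"])
  show "computes (\<lambda>s. (case s of (v, x) \<Rightarrow> v r \<le> 1) \<and> fst s r \<noteq> 0)
    (\<lambda>(v, inp, I, ih, out). (v(r := v r - 1), inp, I, ih, out @ [b]))"
    by (rule computes_seq[OF computes_emit[of b] computes_reg_prog[OF prog_dec[of r]]]) auto
qed auto

text \<open>Register 1 holds \<open>v 0 - 1\<close> and controls the loop, so it stops when only the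
  end mark is left. Registers 2 and 3 are complementary flags for the lowest bit, each triggering
  the output of one letter.\<close>

lemma computes_output:
  "computes (\<lambda>(v, inp, I, ih, out). clean 0 v)
    (\<lambda>(v, inp, I, ih, out). (v(0 := min 1 (v 0)), inp, I, ih, out @ decode (v 0)))"
proof -
  have 1: "computes (\<lambda>(v, x). v 2 \<le> 1 \<and> v 3 = 1 - v 2) (\<lambda>(v, inp, I, ih, out).
      (v(2 := 0, 3 := 0), inp, I, ih, out @ [v 2 = 1]))"
    by (rule computes_seq[OF computes_emit_if[of 2 True] computes_emit_if[of 3 False]]) auto
  have 2: "computes (\<lambda>(v, x). clean 1 v) (\<lambda>(v, inp, I, ih, out).
      (v, inp, I, ih, out @ [odd (v 0)]))"
    by (rule computes_seq[OF computes_reg_prog[OF prog_parity] 1])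
      (auto simp: clean_def fun_eq_iff odd_iff_mod_2_eq_one)
  have body: "computes (\<lambda>(v, x). clean 1 v) (\<lambda>(v, inp, I, ih, out).
      (v(0 := v 0 div 2, 1 := v 0 div 2 - 1), inp, I, ih, out @ [odd (v 0)]))"
    by (rule computes_seq[OF 2 computes_reg_prog[OF prog_halve]]) auto
  have loop: "computes (\<lambda>(v, x). clean 1 v \<and> v 1 = v 0 - 1) (\<lambda>(v, inp, I, ih, out).
      (v(0 := min 1 (v 0), 1 := 0), inp, I, ih, out @ decode (v 0)))"
  proof (rule computes_while[where r = 1 and \<mu> = "\<lambda>s. fst s 0"])
    show "computes (\<lambda>s. (case s of (v, x) \<Rightarrow> clean 1 v \<and> v 1 = v 0 - 1) \<and> fst s 1 \<noteq> 0)
      (\<lambda>(v, inp, I, ih, out). (v(0 := v 0 div 2, 1 := v 0 div 2 - 1), inp, I, ih, out @ [odd (v 0)]))"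
      by (rule computes_weaken[OF body]) auto
  next
    fix s :: mstate
    obtain v inp I ih out where s: "s = (v, inp, I, ih, out)" by (cases s)
    assume "case s of (v, x) \<Rightarrow> clean 1 v \<and> v 1 = v 0 - 1" "fst s 1 \<noteq> 0"
    moreover have "decode (v 0) = odd (v 0) # decode (v 0 div 2)" if "v 0 > 1"
      using that by (subst decode.simps) simp
    ultimately show "(case (case s of (v, inp, I, ih, out) \<Rightarrow>
        (v(0 := v 0 div 2, 1 := v 0 div 2 - 1), inp, I, ih, out @ [odd (v 0)]))
        of (v, x) \<Rightarrow> clean 1 v \<and> v 1 = v 0 - 1) \<and>
      fst (case s of (v, inp, I, ih, out) \<Rightarrow>
        (v(0 := v 0 div 2, 1 := v 0 div 2 - 1), inp, I, ih, out @ [odd (v 0)])) 0 < fst s 0 \<and>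
      (case s of (v, inp, I, ih, out) \<Rightarrow>
        (v(0 := min 1 (v 0), 1 := 0), inp, I, ih, out @ decode (v 0))) =
      (case (case s of (v, inp, I, ih, out) \<Rightarrow>
        (v(0 := v 0 div 2, 1 := v 0 div 2 - 1), inp, I, ih, out @ [odd (v 0)]))
       of (v, inp, I, ih, out) \<Rightarrow>
        (v(0 := min 1 (v 0), 1 := 0), inp, I, ih, out @ decode (v 0)))"
      by (auto simp: s clean_def fun_eq_iff)
  next
    fix s :: mstate
    obtain v inp I ih out where s: "s = (v, inp, I, ih, out)" by (cases s)
    assume "case s of (v, x) \<Rightarrow> clean 1 v \<and> v 1 = v 0 - 1" "fst s 1 = 0"
    moreover have "decode (v 0) = []" if "v 0 \<le> 1"
      using that by (subst decode.simps) simp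
    ultimately show "(case s of (v, inp, I, ih, out) \<Rightarrow>
        (v(0 := min 1 (v 0), 1 := 0), inp, I, ih, out @ decode (v 0))) = s"
      by (auto simp: s fun_eq_iff)
  qed
  have 3: "reg_prog (clean 0) (\<lambda>v. v(1 := v 0 - 1))"
    by (rule prog_seq[OF prog_copy[of 0 1 2] prog_dec[of 1]]) (auto simp: clean_def)
  show ?thesis
    by (rule computes_seq[OF computes_reg_prog[OF 3] loop]) (auto simp: clean_def fun_eq_iff)
qed

section \<open>Input and output\<close>

definition word :: "(nat \<Rightarrow> sym) \<Rightarrow> bool list" where
  "word I = (THE x. I = enc1 x)"

lemma Least_enc1: "(LEAST j. enc1 x j = Bl) = length x"
proof (rule Least_equality)
  show "enc1 x (length x) = Bl" by (simp add: enc1_def)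
  show "length x \<le> j" if "enc1 x j = Bl" for j
    using that by (auto simp: enc1_def bitsym_def split: if_splits)
qed

lemma enc1_inject: "enc1 x = enc1 y \<longleftrightarrow> x = y"
proof
  assume e: "enc1 x = enc1 y"
  then have l: "length x = length y" using Least_enc1[of x] Least_enc1[of y] by simp
  moreover have "x ! i = y ! i" if "i < length x" for i
    using fun_cong[OF e, of i] that l by (auto simp: enc1_def bitsym_def split: if_splits)
  ultimately show "x = y" by (simp add: list_eq_iff_nth_eq)
qed simp

lemma word_enc1 [simp]: "word (enc1 x) = x"
  unfolding word_def by (simp add: enc1_inject)

fun binval :: "bool list \<Rightarrow> nat" where
  "binval [] = 0"
| "binval (b # x) = of_bool b + 2 * binval x"

lemma addr_enc1: "addr (enc1 x) = binval x"
proof -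
  have "(\<Sum>i<length x. if enc1 x i = Os then 2 ^ i else 0) = binval x"
  proof (induction x)
    case (Cons b x)
    have "(\<Sum>i<length (b # x). if enc1 (b # x) i = Os then 2 ^ i else 0) =
      of_bool b + (\<Sum>i<length x. if enc1 x i = Os then 2 ^ Suc i else (0 :: nat))"
      unfolding length_Cons sum.lessThan_Suc_shift
      by (intro arg_cong2[where f = "(+)"] sum.cong) (auto simp: enc1_def bitsym_def)
    also have "(\<Sum>i<length x. if enc1 x i = Os then 2 ^ Suc i else (0 :: nat)) =
      2 * (\<Sum>i<length x. if enc1 x i = Os then 2 ^ i else 0)"
      unfolding sum_distrib_left by (rule sum.cong) auto
    finally show ?case using Cons by simp
  qed simp
  then show ?thesis unfolding addr_def Least_enc1 .
qed

definition incr :: "bool list \<Rightarrow> bool list" where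
  "incr x = (let j = length (takeWhile id x) in replicate j False @ True # drop (Suc j) x)"

lemma binval_incr: "binval (incr x) = Suc (binval x)"
proof (induction x)
  case (Cons b x)
  then show ?case by (cases b) (auto simp: incr_def Let_def)
qed (simp add: incr_def)

lemma enc1_replicate_upd:
  "(enc1 (replicate n False @ zs))(n := bitsym b) = enc1 (replicate n False @ b # tl zs)"
  by (rule ext) (auto simp: enc1_def nth_append nth_Cons nth_tl split: nat.split)

lemma enc1_replicate_nth: "enc1 (replicate n False @ ys) n = Os \<longleftrightarrow> ys \<noteq> [] \<and> hd ys"
  by (cases ys) (auto simp: enc1_def bitsym_def nth_append)

definition at_index :: "mstate \<Rightarrow> bool" where
  "at_index s = (case s of (v, inp, I, ih, out) \<Rightarrow> v 1 = ih \<and> (\<exists>ys. I = enc1 (replicate ih False @ ys)))"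

text \<open>Register 1 counts the moves of the index head, which is how the head finds its way back to cell 0.\<close>
lemma computes_index_incr:
  "computes (\<lambda>(v, inp, I, ih, out). v 1 = 0 \<and> ih = 0 \<and> (\<exists>x. I = enc1 x))
     (\<lambda>(v, inp, I, ih, out). (v, inp, enc1 (incr (word I)), 0, out))"
proof -
  have body1: "computes (\<lambda>_. True) (\<lambda>(v, inp, I, ih, out).
      (v(1 := v 1 + 1), inp, I(ih := Zs), ih + 1, out))"
    by (rule computes_seq[OF computes_index[of "\<lambda>_. Zs" Rgt] computes_reg_prog[OF prog_inc[of 1]]]) auto
  let ?j = "\<lambda>ih I. length (takeWhile id (drop ih (word I)))"
  let ?G = "\<lambda>(v, inp, I, ih, out). (v(1 := v 1 + ?j ih I), inp,
      enc1 (replicate (ih + ?j ih I) False @ drop (ih + ?j ih I) (word I)), ih + ?j ih I, out) :: mstate"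
  have loop1: "computes at_index ?G"
  proof (rule computes_ext_while[where \<phi> = "\<lambda>x z. z = Os" and \<mu> = "\<lambda>(v, inp, I, ih, out). ?j ih I"])
    show "computes (\<lambda>s. at_index s \<and> ext_holds (\<lambda>x z. z = Os) s)
      (\<lambda>(v, inp, I, ih, out). (v(1 := v 1 + 1), inp, I(ih := Zs), ih + 1, out))"
      by (rule computes_weaken[OF body1]) auto
  next
    fix s :: mstate
    obtain v inp I ih out where s: "s = (v, inp, I, ih, out)" by (cases s)
    let ?s' = "(v(1 := v 1 + 1), inp, I(ih := Zs), ih + 1, out)"
    assume 1: "at_index s" and 2: "ext_holds (\<lambda>x z. z = Os) s"
    then obtain ys where ys: "I = enc1 (replicate ih False @ ys)" and v: "v 1 = ih"
      by (auto simp: s at_index_def)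
    with 2 have "ys \<noteq> [] \<and> hd ys" using enc1_replicate_nth by (simp add: s ext_holds_def)
    then obtain zs where zs: "ys = True # zs" by (cases ys) auto
    have I': "I(ih := Zs) = enc1 (replicate (ih + 1) False @ zs)"
      using enc1_replicate_upd[of ih ys False] by (simp add: ys zs bitsym_def replicate_append_same[symmetric])
    have w: "word I = replicate ih False @ True # zs" "word (I(ih := Zs)) = replicate (ih + 1) False @ zs"
      unfolding I' by (simp_all add: ys zs)
    have "at_index ?s'" unfolding at_index_def using I' v by auto
    moreover have "?j (ih + 1) (I(ih := Zs)) < ?j ih I" unfolding w by simp
    moreover have "?G s = ?G ?s'" unfolding s prod.case w by (simp add: fun_eq_iff)
    ultimately show "at_index (case s of (v, inp, I, ih, out) \<Rightarrow>
        (v(1 := v 1 + 1), inp, I(ih := Zs), ih + 1, out)) \<and>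
      (case (case s of (v, inp, I, ih, out) \<Rightarrow> (v(1 := v 1 + 1), inp, I(ih := Zs), ih + 1, out))
        of (v, inp, I, ih, out) \<Rightarrow> ?j ih I) < (case s of (v, inp, I, ih, out) \<Rightarrow> ?j ih I) \<and>
      ?G s = ?G (case s of (v, inp, I, ih, out) \<Rightarrow> (v(1 := v 1 + 1), inp, I(ih := Zs), ih + 1, out))"
      by (simp only: s prod.case simp_thms)
  next
    fix s :: mstate
    obtain v inp I ih out where s: "s = (v, inp, I, ih, out)" by (cases s)
    assume 1: "at_index s" and 2: "\<not> ext_holds (\<lambda>x z. z = Os) s"
    then obtain ys where ys: "I = enc1 (replicate ih False @ ys)" by (auto simp: s at_index_def)
    with 2 have "ys = [] \<or> \<not> hd ys" using enc1_replicate_nth by (simp add: s ext_holds_def)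
    then have "takeWhile id ys = []" by (cases ys) auto
    then show "?G s = s" by (simp add: s ys)
  qed
  have 2: "computes (\<lambda>(v, inp, I, ih, out). v 1 = 0 \<and> ih = 0 \<and> (\<exists>x. I = enc1 x))
    (\<lambda>(v, inp, I, ih, out). (v(1 := ?j 0 I), inp, enc1 (incr (word I)), ?j 0 I, out))"
    by (rule computes_seq[OF loop1 computes_index[of "\<lambda>_. Os" Stay]])
      (use enc1_replicate_upd[of _ _ True] in \<open>auto simp: at_index_def bitsym_def incr_def Let_def drop_Suc tl_drop\<close>)
  have body3: "computes (\<lambda>_. True) (\<lambda>(v, inp, I, ih, out).
      (v(1 := v 1 - 1), inp, I, ih - 1, out))"
    by (rule computes_seq[OF computes_index[of "\<lambda>x. x" Lft] computes_reg_prog[OF prog_dec[of 1]]]) auto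
  have loop3: "computes (\<lambda>_. True) (\<lambda>(v, inp, I, ih, out).
      (v(1 := 0), inp, I, ih - v 1, out))"
    by (rule computes_while[where r = 1 and \<mu> = "\<lambda>s. fst s 1"], rule computes_weaken[OF body3]) auto
  show ?thesis
    by (rule computes_seq[OF 2 loop3]) auto
qed

text \<open>Doubling and adding makes each new letter the lowest bit, that is, the head of the coded
  word; what has been read is therefore stored reversed. This is the origin of
  \<open>code (rev p)\<close> in \<open>recfn_tm\<close>.\<close>

definition word_state :: "bool list \<Rightarrow> nat \<Rightarrow> bool list \<Rightarrow> mstate" where
  "word_state p i out = ((\<lambda>_. 0)(0 := code (rev (take i p))), enc1 p, enc1 ((incr ^^ i) []), 0, out)"

lemma binval_incr_power: "binval ((incr ^^ i) []) = i"
  by (induction i) (simp_all add: binval_incr)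

lemma computes_read:
  "computes (\<lambda>s. \<exists>p out. s = word_state p 0 out)
     (\<lambda>(v, inp, I, ih, out). word_state (word inp) (length (word inp)) out)"
proof -
  have 1: "reg_prog (clean 0) (\<lambda>v. v(0 := 2 * v 0))"
    by (rule recfn_prog) (intro recfn_rules)
  have 2: "computes (\<lambda>_. True) (\<lambda>s. if ext_holds (\<lambda>x z. x = Os) s then
      (case s of (v, x) \<Rightarrow> (v(0 := v 0 + 1), x)) else s)"
    by (rule computes_ext_if[OF computes_weaken[OF computes_reg_prog[OF prog_inc[of 0]]]]) auto
  have 3: "computes (\<lambda>(v, inp, I, ih, out). clean 0 v) (\<lambda>(v, inp, I, ih, out).
     (v(0 := 2 * v 0 + (if inp (addr I) = Os then 1 else 0)), inp, I, ih, out))"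
    by (rule computes_seq[OF computes_reg_prog[OF 1] 2]) (auto simp: ext_holds_def)
  have body: "computes (\<lambda>(v, inp, I, ih, out). clean 0 v \<and> ih = 0 \<and> (\<exists>x. I = enc1 x))
     (\<lambda>(v, inp, I, ih, out). (v(0 := 2 * v 0 + (if inp (addr I) = Os then 1 else 0)), inp,
        enc1 (incr (word I)), 0, out))"
    by (rule computes_seq[OF 3 computes_index_incr]) (auto simp: clean_def)
  let ?P = "\<lambda>s. \<exists>p i out. i \<le> length p \<and> s = word_state p i out"
  have step: "(case word_state p i out of (v, inp, I, ih, out) \<Rightarrow>
        (v(0 := 2 * v 0 + (if inp (addr I) = Os then 1 else 0)), inp, enc1 (incr (word I)), 0, out))
      = word_state p (Suc i) out" if "i < length p" for p i out
    using that by (auto simp: word_state_def addr_enc1 binval_incr_power take_Suc_conv_app_nth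
      enc1_def bitsym_def fun_eq_iff)
  have test: "ext_holds (\<lambda>x z. x \<noteq> Bl) (word_state p i out) \<longleftrightarrow> i < length p" for p i out
    by (auto simp: ext_holds_def word_state_def addr_enc1 binval_incr_power enc1_def bitsym_def)
  have "computes ?P (\<lambda>(v, inp, I, ih, out). word_state (word inp) (length (word inp)) out)"
  proof (rule computes_ext_while[where \<phi> = "\<lambda>x z. x \<noteq> Bl" and
        \<mu> = "\<lambda>(v, inp, I, ih, out). length (word inp) - addr I"])
    show "computes (\<lambda>s. ?P s \<and> ext_holds (\<lambda>x z. x \<noteq> Bl) s)
      (\<lambda>(v, inp, I, ih, out). (v(0 := 2 * v 0 + (if inp (addr I) = Os then 1 else 0)), inp,
        enc1 (incr (word I)), 0, out))"
      by (rule computes_weaken[OF body]) (auto simp: word_state_def clean_def)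
  next
    fix s assume "?P s" "ext_holds (\<lambda>x z. x \<noteq> Bl) s"
    then obtain p i out where s: "s = word_state p i out" and i: "i < length p" using test by auto
    show "?P (case s of (v, inp, I, ih, out) \<Rightarrow>
        (v(0 := 2 * v 0 + (if inp (addr I) = Os then 1 else 0)), inp, enc1 (incr (word I)), 0, out)) \<and>
      (case (case s of (v, inp, I, ih, out) \<Rightarrow>
        (v(0 := 2 * v 0 + (if inp (addr I) = Os then 1 else 0)), inp, enc1 (incr (word I)), 0, out))
       of (v, inp, I, ih, out) \<Rightarrow> length (word inp) - addr I) <
      (case s of (v, inp, I, ih, out) \<Rightarrow> length (word inp) - addr I) \<and>
      (case s of (v, inp, I, ih, out) \<Rightarrow> word_state (word inp) (length (word inp)) out) =
      (case (case s of (v, inp, I, ih, out) \<Rightarrow>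
        (v(0 := 2 * v 0 + (if inp (addr I) = Os then 1 else 0)), inp, enc1 (incr (word I)), 0, out))
       of (v, inp, I, ih, out) \<Rightarrow> word_state (word inp) (length (word inp)) out)"
      unfolding s step[OF i]
    proof (intro conjI)
      show "?P (word_state p (Suc i) out)" using i Suc_leI by blast
    qed (use i in \<open>simp_all add: word_state_def addr_enc1 binval_incr binval_incr_power\<close>)
  next
    fix s assume "?P s" "\<not> ext_holds (\<lambda>x z. x \<noteq> Bl) s"
    then obtain p i out where s: "s = word_state p i out" and i: "i = length p"
      using test by (metis le_neq_implies_less)
    show "(case s of (v, inp, I, ih, out) \<Rightarrow> word_state (word inp) (length (word inp)) out) = s"
      unfolding s i by (simp add: word_state_def)
  qed
  then show ?thesis by (rule computes_weaken) auto
qed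

lemma enc1_Nil: "enc1 [] = (\<lambda>_. Bl)"
  by (rule ext) (simp add: enc1_def)

text \<open>A halted configuration is a fixed point of \<open>step\<close>. Besides fixing outputs,
  this allows \<open>t\<close> to be replaced by a larger bound that is easier to compute.\<close>

lemma halted_run_mono:
  assumes "halted_state (cstate (run M inp m))" "m \<le> n"
  shows "run M inp n = run M inp m"
proof -
  have "(step M inp ^^ j) (run M inp m) = run M inp m" for j
    using assms(1) by (induction j) (auto simp: step_def cstate_def split: prod.split)
  moreover have "run M inp n = (step M inp ^^ (n - m)) (run M inp m)"
    using assms(2) by (simp add: run_def funpow_add[symmetric, THEN fun_cong, unfolded o_apply])
  ultimately show ?thesis by simp
qed

lemma eval_eqI:
  assumes "halted_state (cstate (run M (enc1 w) n))" "tm_output (run M (enc1 w) n) = x"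
  shows "eval M w = Some x"
proof -
  let ?h = "\<lambda>n. halted_state (cstate (run M (enc1 w) n))"
  have "?h (LEAST n. ?h n)" "(LEAST n. ?h n) \<le> n" using assms(1) by (rule LeastI, rule Least_le)
  then have "run M (enc1 w) n = run M (enc1 w) (LEAST n. ?h n)" by (rule halted_run_mono)
  then show ?thesis using assms by (auto simp: eval_def)
qed

lemma tm_output_enc1:
  assumes "\<And>i. fst (snd c) (int i) = enc1 x i"
  shows "tm_output c = x"
proof -
  have "tm_output c = map (\<lambda>i. enc1 x i = Os) [0..<length x]"
    using assms by (cases c) (simp add: tm_output_def Least_enc1)
  also have "\<dots> = x" by (rule nth_equalityI) (auto simp: enc1_def bitsym_def)
  finally show ?thesis .
qed

theorem recfn_tm:
  assumes "recfn f"
  shows "\<exists>M. wf_tm M \<and> (\<forall>p. eval M p = Some (decode (f (code (rev p)))))"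
proof -
  \<comment> \<open>Registers start at 0, but reading starts from \<open>code [] = 1\<close>, the
    end mark.\<close>
  have inc: "computes (\<lambda>(v, x). v = (\<lambda>_. 0)) (\<lambda>(v, x). (v(0 := v 0 + 1), x))"
    by (rule computes_weaken[OF computes_reg_prog[OF prog_inc]]) auto
  have 1: "computes (\<lambda>s. \<exists>p. s = (\<lambda>_. 0, enc1 p, \<lambda>_. Bl, 0, []))
    (\<lambda>(v, inp, I, ih, out). word_state (word inp) (length (word inp)) out)"
    by (rule computes_seq[OF inc computes_read])
      (auto simp: word_state_def enc1_Nil intro!: exI)
  have 2: "computes (\<lambda>s. \<exists>p. s = (\<lambda>_. 0, enc1 p, \<lambda>_. Bl, 0, []))
    (\<lambda>(v, inp, I, ih, out). case word_state (word inp) (length (word inp)) out of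
      (v, inp, I, ih, out) \<Rightarrow> (v(0 := f (v 0)), inp, I, ih, out))"
    by (rule computes_seq[OF 1 computes_reg_prog[OF recfn_prog[OF assms, of 0]]])
      (auto simp: word_state_def clean_def)
  define F :: "mstate \<Rightarrow> mstate" where "F = (\<lambda>(v, inp, I, ih, out).
      case word_state (word inp) (length (word inp)) out of
      (v, inp, I, ih, out) \<Rightarrow> (v(0 := min 1 (f (v 0))), inp, I, ih, out @ decode (f (v 0))))"
  have "computes (\<lambda>s. \<exists>p. s = (\<lambda>_. 0, enc1 p, \<lambda>_. Bl, 0, [])) F"
    by (rule computes_seq[OF 2 computes_output]) (auto simp: F_def word_state_def clean_def)
  then obtain k where "real_fun k (\<lambda>s. \<exists>p. s = (\<lambda>_. 0, enc1 p, \<lambda>_. Bl, 0, [])) F" and "0 < k"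
    using eventually_happens[OF eventually_conj[OF _ eventually_gt_at_top[of 0]]]
    unfolding computes_def by auto
  then obtain n G where B: "block n G {(emb k s, emb k (F s)) | s. \<exists>p. s = (\<lambda>_. 0, enc1 p, \<lambda>_. Bl, 0, [])}"
    unfolding real_fun_def realizable_def by blast
  \<comment> \<open>States 0, 3 and 4 walk to cell \<open>- 2\<close> and write the marker there,
    which turns the blank tape into the register tape with all registers zero. The block starts at 5
    and exits to the accepting state 1.\<close>
  define M :: tm where "M = \<lparr>nst = 5 + n, delta = (\<lambda>q x y z.
     if q = 0 then (3, Bl, Lft, Bl, Stay) else if q = 3 then (4, Bl, Lft, Bl, Stay)
     else if q = 4 then (5, Os, Stay, Bl, Stay)
     else if 5 \<le> q \<and> q < 5 + n then G 5 1 q x y z else (1, Bl, Stay, Bl, Stay))\<rparr>"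
  have "wf_tm M" unfolding wf_tm_def
  proof (intro conjI allI impI)
    fix q a b c assume "q < nst M"
    then show "fst (delta M q a b c) < nst M"
      using block_exit[OF B, of 5 q 1 a b c] block_pos[OF B] by (auto simp: M_def)
  qed (simp add: M_def)
  moreover have "eval M p = Some (decode (f (code (rev p))))" for p
  proof -
    let ?s = "(\<lambda>_. 0, enc1 p, \<lambda>_. Bl, 0, []) :: mstate"
    have "reg_tape k (\<lambda>_. 0) [] = (\<lambda>_. Bl)(- 2 := Os)"
      by (rule ext) (auto simp: reg_tape_def enc1_def)
    then have "(step M (enc1 p) ^^ 3) init_config = (5, snd (emb k ?s))"
      by (simp add: eval_nat_numeral init_config_def step_def halted_state_def M_def emb_def fun_eq_iff)
    moreover have "reaches M 5 (emb k ?s) 1 (emb k (F ?s))"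
      by (rule block_reaches[OF B]) (auto simp: M_def)
    then obtain m where "(step M (enc1 p) ^^ m) (5, snd (emb k ?s)) = (1, snd (emb k (F ?s)))"
      unfolding reaches_def by (auto simp: emb_def)
    ultimately have r: "run M (enc1 p) (m + 3) = (1, snd (emb k (F ?s)))"
      unfolding run_def funpow_add o_apply by simp
    obtain v inp I ih where F: "F ?s = (v, inp, I, ih, decode (f (code (rev p))))"
      by (simp add: F_def word_state_def)
    have "tm_output (run M (enc1 p) (m + 3)) = decode (f (code (rev p)))"
      unfolding r by (rule tm_output_enc1) (simp add: emb_def F reg_tape_def)
    then show ?thesis
      by (rule eval_eqI[rotated]) (simp add: r cstate_def halted_state_def)
  qed
  ultimately show ?thesis by blast
qed

section \<open>Simulation of machines\<close>

fun sym_code :: "sym \<Rightarrow> nat" where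
  "sym_code Bl = 0" | "sym_code Zs = 1" | "sym_code Os = 2"

fun dir_code :: "dir \<Rightarrow> nat" where
  "dir_code Lft = 0" | "dir_code Stay = 1" | "dir_code Rgt = 2"

lemma sym_code_eq_iff: "sym_code a = sym_code b \<longleftrightarrow> a = b"
  by (cases a; cases b) auto

text \<open>A tape is coded by two bit masks: \<open>A\<close> marks the nonblank cells and \<open>B\<close> the cells holding \<open>Os\<close>.\<close>
definition sym_at :: "nat \<Rightarrow> nat \<Rightarrow> nat \<Rightarrow> nat" where
  "sym_at A B i = (if bit A i then if bit B i then 2 else 1 else 0)"

definition put_bit :: "nat \<Rightarrow> nat \<Rightarrow> nat \<Rightarrow> nat" where
  "put_bit b A i = (if b = 0 then (if bit A i then A - 2 ^ i else A) else (if bit A i then A else A + 2 ^ i))"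

definition mask_addr :: "nat \<Rightarrow> nat \<Rightarrow> nat" where
  "mask_addr A B = B mod 2 ^ (LEAST j. \<not> bit A j)"

text \<open>Digit \<open>i\<close> of \<open>h\<close> in base \<open>2 ^ w\<close>. Searching over
  numbers thus becomes searching over lists of \<open>w\<close>-bit entries; transition tables and
  hitting lists are both stored this way.\<close>

definition elem :: "nat \<Rightarrow> nat \<Rightarrow> nat \<Rightarrow> nat" where
  "elem w h i = (h div 2 ^ (w * i)) mod 2 ^ w"

text \<open>Every number is some transition table, so a quantifier over machine codes needs no test
  of validity.\<close>

definition entry :: "nat \<Rightarrow> nat \<Rightarrow> nat \<Rightarrow> nat \<Rightarrow> nat \<Rightarrow> nat" where
  "entry m q a b c = elem (pfst m) (psnd m) (prod_encode (q, prod_encode (a, prod_encode (b, c))))"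

definition config_code :: "nat \<Rightarrow> nat \<Rightarrow> nat \<Rightarrow> nat \<Rightarrow> nat \<Rightarrow> nat \<Rightarrow> nat \<Rightarrow> nat" where
  "config_code q A B wh C D ih =
     prod_encode (q, prod_encode (A, prod_encode (B, prod_encode (wh, prod_encode (C, prod_encode (D, ih))))))"

definition act_code :: "nat \<Rightarrow> nat \<Rightarrow> nat \<Rightarrow> nat \<Rightarrow> nat \<Rightarrow> nat" where
  "act_code q w dw i di = prod_encode (q, prod_encode (w, prod_encode (dw, prod_encode (i, di))))"

text \<open>A symbol code is nonzero for mask \<open>A\<close>, and its predecessor nonzero for mask
  \<open>B\<close>. Directions are 0, 1, 2 with offset 1; truncated subtraction reproduces the index
  head staying at cell 0 on a left move.\<close>

definition apply_act :: "nat \<Rightarrow> nat \<Rightarrow> nat \<Rightarrow> nat \<Rightarrow> nat \<Rightarrow> nat \<Rightarrow> nat \<Rightarrow> nat" where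
  "apply_act e A B wh C D ih =
     config_code (pfst e)
       (put_bit (pfst (psnd e)) A wh) (put_bit (pfst (psnd e) - 1) B wh)
       (wh + pfst (psnd (psnd e)) - 1)
       (put_bit (pfst (psnd (psnd (psnd e)))) C ih) (put_bit (pfst (psnd (psnd (psnd e))) - 1) D ih)
       (ih + psnd (psnd (psnd (psnd e))) - 1)"

definition sim_core :: "(nat \<Rightarrow> nat) \<Rightarrow> nat \<Rightarrow> nat \<Rightarrow> nat \<Rightarrow> nat \<Rightarrow> nat \<Rightarrow> nat \<Rightarrow> nat \<Rightarrow> nat \<Rightarrow> nat" where
  "sim_core inp m q A B wh C D ih =
     (if q = 1 \<or> q = 2 then config_code q A B wh C D ih
      else apply_act (entry m q (inp (mask_addr C D)) (sym_at A B wh) (sym_at C D ih)) A B wh C D ih)"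

definition sim_step :: "(nat \<Rightarrow> nat) \<Rightarrow> nat \<Rightarrow> nat \<Rightarrow> nat" where
  "sim_step inp m y = sim_core inp m (pfst y) (pfst (psnd y)) (pfst (psnd (psnd y)))
     (pfst (psnd (psnd (psnd y)))) (pfst (psnd (psnd (psnd (psnd y)))))
     (pfst (psnd (psnd (psnd (psnd (psnd y)))))) (psnd (psnd (psnd (psnd (psnd (psnd y))))))"

text \<open>The work tape is shifted by the number \<open>T\<close> of steps, so that the head stays at nonnegative positions.\<close>
definition sim :: "(nat \<Rightarrow> nat) \<Rightarrow> nat \<Rightarrow> nat \<Rightarrow> nat" where
  "sim inp m T = (sim_step inp m ^^ T) (config_code 0 0 0 T 0 0 0)"

lemma not_bit_self: "\<not> bit (n :: nat) n"
  by (simp add: bit_iff_odd less_exp)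

lemma bit_put_bit: "bit (put_bit b A i) j \<longleftrightarrow> (if j = i then b \<noteq> 0 else bit A j)"
proof -
  have "A - 2 ^ i = unset_bit i A" if "bit A i"
  proof -
    have "A = set_bit i (unset_bit i A)"
      using that by (intro bit_eqI) (auto simp: bit_set_bit_iff bit_unset_bit_iff)
    then have "A = unset_bit i A + 2 ^ i"
      unfolding set_bit_eq[of i "unset_bit i A"] by (simp add: bit_unset_bit_iff)
    then show ?thesis by simp
  qed
  moreover have "unset_bit i A = A" if "\<not> bit A i"
    using that by (intro bit_eqI) (auto simp: bit_unset_bit_iff)
  ultimately have "put_bit b A i = (if b = 0 then unset_bit i A else set_bit i A)"
    by (simp add: put_bit_def set_bit_eq)
  then show ?thesis by (auto simp: bit_unset_bit_iff bit_set_bit_iff)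
qed

lemma sym_at_put:
  assumes "s \<le> 2"
  shows "sym_at (put_bit s A i) (put_bit (s - 1) B i) j = (if j = i then s else sym_at A B j)"
  using assms by (auto simp: sym_at_def bit_put_bit)

lemma recfn_sym_at: "recfn a \<Longrightarrow> recfn b \<Longrightarrow> recfn i \<Longrightarrow> recfn (\<lambda>z. sym_at (a z) (b z) (i z))"
  unfolding sym_at_def by (intro recfn_rules)

lemma recfn_put_bit: "recfn a \<Longrightarrow> recfn b \<Longrightarrow> recfn i \<Longrightarrow> recfn (\<lambda>z. put_bit (a z) (b z) (i z))"
  unfolding put_bit_def by (intro recfn_rules)

lemma recfn_mask_addr: "recfn a \<Longrightarrow> recfn b \<Longrightarrow> recfn (\<lambda>z. mask_addr (a z) (b z))"
proof (rule recfn_app2[where F = mask_addr])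
  show "recfn (\<lambda>z. mask_addr (pfst z) (psnd z))"
    unfolding mask_addr_def
    by (intro recfn_rules recfn_Least) (use not_bit_self in blast)
qed

lemma recfn_elem: "recfn a \<Longrightarrow> recfn b \<Longrightarrow> recfn i \<Longrightarrow> recfn (\<lambda>z. elem (a z) (b z) (i z))"
  unfolding elem_def by (intro recfn_rules)

lemma recfn_entry:
  "recfn m \<Longrightarrow> recfn q \<Longrightarrow> recfn a \<Longrightarrow> recfn b \<Longrightarrow> recfn c \<Longrightarrow>
   recfn (\<lambda>z. entry (m z) (q z) (a z) (b z) (c z))"
  unfolding entry_def by (intro recfn_rules recfn_elem)

lemma recfn_apply_act:
  "recfn e \<Longrightarrow> recfn a \<Longrightarrow> recfn b \<Longrightarrow> recfn wh \<Longrightarrow> recfn c \<Longrightarrow> recfn d \<Longrightarrow> recfn ih \<Longrightarrow>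
   recfn (\<lambda>z. apply_act (e z) (a z) (b z) (wh z) (c z) (d z) (ih z))"
  unfolding apply_act_def config_code_def by (intro recfn_rules recfn_put_bit)

lemma recfn_sim:
  assumes inp: "recfn (\<lambda>w. inp (pfst w) (psnd w))" and m: "recfn m" and "recfn T"
  shows "recfn (\<lambda>z. sim (inp z) (m z) (T z))"
  unfolding sim_def
proof (rule recfn_funpow)
  show "recfn (\<lambda>w. sim_step (inp (pfst w)) (m (pfst w)) (psnd w))"
    unfolding sim_step_def sim_core_def config_code_def
    by (intro recfn_rules recfn_apply_act recfn_entry recfn_app2[OF inp] recfn_mask_addr recfn_sym_at
      recfn_comp[OF m])
  show "recfn (\<lambda>z. config_code 0 0 0 (T z) 0 0 0)"
    unfolding config_code_def by (intro recfn_rules assms(3))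
qed (rule assms(3))

lemma ex_elem:
  assumes "\<And>i. i < k \<Longrightarrow> f i < 2 ^ w"
  shows "\<exists>h. \<forall>i<k. elem w h i = f i"
  using assms
proof (induction k arbitrary: f)
  case (Suc k)
  then obtain h where h: "\<forall>i<k. elem w h i = f (Suc i)"
    using Suc.IH[of "\<lambda>i. f (Suc i)"] Suc.prems by (meson Suc_less_eq)
  have "elem w (f 0 + 2 ^ w * h) i = f i" if "i < Suc k" for i
  proof (cases i)
    case 0
    then show ?thesis using Suc.prems by (simp add: elem_def)
  next
    case (Suc j)
    have "(f 0 + 2 ^ w * h) div 2 ^ (w * i) = (f 0 + 2 ^ w * h) div 2 ^ w div 2 ^ (w * j)"
      by (simp add: Suc power_add div_mult2_eq)
    also have "(f 0 + 2 ^ w * h) div 2 ^ w = h" using Suc.prems by simp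
    finally show ?thesis using h Suc that by (simp add: elem_def)
  qed
  then show ?case by blast
qed simp

fun action_code :: "nat \<times> sym \<times> dir \<times> sym \<times> dir \<Rightarrow> nat" where
  "action_code (q, w, dw, i, di) = act_code q (sym_code w) (dir_code dw) (sym_code i) (dir_code di)"

definition codes_tm :: "tm \<Rightarrow> nat \<Rightarrow> bool" where
  "codes_tm M m \<longleftrightarrow> (\<forall>q<nst M. \<forall>a b c.
     entry m q (sym_code a) (sym_code b) (sym_code c) = action_code (delta M q a b c))"

lemma ex_codes_tm: "\<exists>m. codes_tm M m"
proof -
  define idx where "idx = (\<lambda>(q, a, b, c). prod_encode (q :: nat, prod_encode (sym_code a,
    prod_encode (sym_code b, sym_code c))))"
  have inj: "inj idx" by (auto simp: inj_def idx_def prod_encode_eq sym_code_eq_iff)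
  define f where "f = (\<lambda>j. case inv idx j of (q, a, b, c) \<Rightarrow> action_code (delta M q a b c))"
  have f: "f (idx (q, a, b, c)) = action_code (delta M q a b c)" for q a b c
    by (simp add: f_def inj)
  have "UNIV = {Bl, Zs, Os}" using sym.exhaust by blast
  then have "finite (UNIV :: sym set)" by (metis finite.simps)
  then have "finite ({..<nst M} \<times> (UNIV :: sym set) \<times> (UNIV :: sym set) \<times> (UNIV :: sym set))"
    by (intro finite_cartesian_product) auto
  then obtain k where k: "\<forall>j \<in> idx ` ({..<nst M} \<times> UNIV \<times> UNIV \<times> UNIV). j < k"
    using finite_nat_set_iff_bounded by blast
  \<comment> \<open>Wide enough for every table entry, since \<open>x < 2 ^ x\<close>.\<close>
  define w where "w = Suc (Max (f ` {..<k}))"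
  have "f i < 2 ^ w" if "i < k" for i
  proof -
    have "f i \<le> Max (f ` {..<k})" using that by (intro Max_ge) auto
    then show ?thesis unfolding w_def by (metis le_imp_less_Suc less_exp less_trans)
  qed
  then obtain h where h: "\<forall>i<k. elem w h i = f i" using ex_elem by blast
  have "codes_tm M (prod_encode (w, h))"
    unfolding codes_tm_def
  proof (intro allI impI)
    fix q a b c assume "q < nst M"
    then have "idx (q, a, b, c) < k" using k by blast
    then have "elem w h (idx (q, a, b, c)) = action_code (delta M q a b c)" using h f by simp
    then show "entry (prod_encode (w, h)) q (sym_code a) (sym_code b) (sym_code c) =
      action_code (delta M q a b c)" by (simp add: entry_def idx_def)
  qed
  then show ?thesis by blast
qed

lemma addr_mask:
  assumes "\<And>i. sym_code (I i) = sym_at C D i"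
  shows "addr I = mask_addr C D"
proof -
  have I: "I j = Bl \<longleftrightarrow> \<not> bit C j" for j
    using assms[of j] sym_code_eq_iff[of "I j" Bl] by (auto simp: sym_at_def split: if_splits)
  let ?L = "LEAST j. \<not> bit C j"
  have "I j = Os \<longleftrightarrow> bit D j" if "j < ?L" for j
    using assms[of j] sym_code_eq_iff[of "I j" Os] not_less_Least[OF that]
    by (auto simp: sym_at_def split: if_splits)
  then have "addr I = (\<Sum>i<?L. of_bool (bit D i) * 2 ^ i)"
    unfolding addr_def I by (intro sum.cong) auto
  also have "\<dots> = take_bit ?L D"
    by (simp add: take_bit_sum push_bit_eq_mult lessThan_atLeast0)
  finally show ?thesis by (simp add: mask_addr_def take_bit_eq_mod)
qed

text \<open>\<open>T\<close> is the length of the whole run, not the number of steps made so far.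
  Cells left of \<open>- int T\<close> are out of reach of the head and are not coded.\<close>

definition codes_config :: "nat \<Rightarrow> nat \<Rightarrow> config \<Rightarrow> bool" where
  "codes_config T y c \<longleftrightarrow> (\<exists>q W wh I ih A B C D.
     c = (q, W, wh, I, ih) \<and> y = config_code q A B (nat (int T + wh)) C D ih \<and> 0 \<le> int T + wh \<and>
     (\<forall>i. - int T \<le> i \<longrightarrow> sym_code (W i) = sym_at A B (nat (int T + i))) \<and>
     (\<forall>i. sym_code (I i) = sym_at C D i))"

lemma sim_step_config: "sim_step inp m (config_code q A B wh C D ih) = sim_core inp m q A B wh C D ih"
  by (simp add: sim_step_def config_code_def)

text \<open>The strict inequality leaves room for one left move; it holds before each of the
  \<open>T\<close> steps because after \<open>j\<close> steps the head is within distance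
  \<open>j\<close> of the origin.\<close>

lemma codes_config_step:
  assumes y: "codes_config T y c" and m: "codes_tm M m" and q: "cstate c < nst M"
    and wh: "0 < int T + fst (snd (snd c))" and inp: "\<And>a. sym_code (inp a) = inpc a"
  shows "codes_config T (sim_step inpc m y) (step M inp c)"
proof -
  obtain q W wh I ih A B C D where c: "c = (q, W, wh, I, ih)"
    and y: "y = config_code q A B (nat (int T + wh)) C D ih"
    and W: "\<And>i. - int T \<le> i \<Longrightarrow> sym_code (W i) = sym_at A B (nat (int T + i))"
    and I: "\<And>i. sym_code (I i) = sym_at C D i"
    using y unfolding codes_config_def by blast
  have wh: "0 < int T + wh" using assms(4) c by simp
  show ?thesis
  proof (cases "halted_state q")
    case True
    then have "q = 1 \<or> q = 2" by (simp add: halted_state_def)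
    then show ?thesis using assms(1) True
      by (simp add: y sim_step_config sim_core_def c step_def)
  next
    case False
    obtain q' w dw i di where d: "delta M q (inp (addr I)) (W wh) (I ih) = (q', w, dw, i, di)"
      by (cases "delta M q (inp (addr I)) (W wh) (I ih)")
    have "entry m q (inpc (mask_addr C D)) (sym_at A B (nat (int T + wh))) (sym_at C D ih) =
      entry m q (sym_code (inp (addr I))) (sym_code (W wh)) (sym_code (I ih))"
      using W[of wh] wh I[of ih] by (simp add: inp addr_mask[OF I])
    also have "\<dots> = action_code (q', w, dw, i, di)"
      using m q by (simp add: codes_tm_def c cstate_def d)
    finally have e: "entry m q (inpc (mask_addr C D)) (sym_at A B (nat (int T + wh))) (sym_at C D ih) =
      act_code q' (sym_code w) (dir_code dw) (sym_code i) (dir_code di)" by simp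
    have le: "sym_code s \<le> 2" for s by (cases s) auto
    let ?A = "put_bit (sym_code w) A (nat (int T + wh))"
    let ?B = "put_bit (sym_code w - 1) B (nat (int T + wh))"
    let ?C = "put_bit (sym_code i) C ih" and ?D = "put_bit (sym_code i - 1) D ih"
    have "nat (int T + wh) + dir_code dw - 1 = nat (int T + mv_int wh dw)"
      using wh by (cases dw) auto
    moreover have "ih + dir_code di - 1 = mv_nat ih di" by (cases di) auto
    moreover have "\<not> (q = 1 \<or> q = 2)" using False by (simp add: halted_state_def)
    ultimately have "sim_step inpc m y = config_code q' ?A ?B (nat (int T + mv_int wh dw)) ?C ?D (mv_nat ih di)"
      by (simp add: y sim_step_config sim_core_def e apply_act_def act_code_def)
    moreover have "step M inp c = (q', W(wh := w), mv_int wh dw, I(ih := i), mv_nat ih di)"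
      using False by (simp add: c step_def d)
    moreover have "0 \<le> int T + mv_int wh dw" using wh by (cases dw) auto
    moreover have "sym_code ((W(wh := w)) j) = sym_at ?A ?B (nat (int T + j))" if "- int T \<le> j" for j
      using W[OF that] that wh by (auto simp: sym_at_put[OF le, unfolded One_nat_def] nat_eq_iff2)
    moreover have "sym_code ((I(ih := i)) j) = sym_at ?C ?D j" for j
      using I[of j] by (simp add: sym_at_put[OF le, unfolded One_nat_def])
    ultimately show ?thesis unfolding codes_config_def by blast
  qed
qed

lemma step_state: "wf_tm M \<Longrightarrow> cstate c < nst M \<Longrightarrow> cstate (step M inp c) < nst M"
proof -
  assume "wf_tm M" "cstate c < nst M"
  moreover obtain q W wh I ih where "c = (q, W, wh, I, ih)" by (cases c)
  ultimately show ?thesis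
    by (cases "delta M q (inp (addr I)) (W wh) (I ih)")
      (auto simp: step_def cstate_def wf_tm_def dest!: spec[of _ q], metis fst_conv)
qed

lemma step_head: "\<bar>fst (snd (snd (step M inp c))) - fst (snd (snd c))\<bar> \<le> 1"
proof -
  obtain q W wh I ih where "c = (q, W, wh, I, ih)" by (cases c)
  moreover have "\<bar>mv_int wh d - wh\<bar> \<le> 1" for d by (cases d) auto
  ultimately show ?thesis by (simp add: step_def split: prod.split)
qed

lemma run_Suc: "run M inp (Suc n) = step M inp (run M inp n)"
  by (simp add: run_def)

lemma run_state: "wf_tm M \<Longrightarrow> cstate (run M inp n) < nst M"
  by (induction n) (auto simp: run_Suc step_state, simp add: run_def init_config_def cstate_def wf_tm_def)

lemma run_head: "\<bar>fst (snd (snd (run M inp n)))\<bar> \<le> int n"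
proof (induction n)
  case (Suc n)
  then show ?case using step_head[of M inp "run M inp n"] by (simp add: run_Suc)
qed (simp add: run_def init_config_def)

lemma sim_run:
  assumes "wf_tm M" "codes_tm M m" "\<And>a. sym_code (inp a) = inpc a"
  shows "pfst (sim inpc m T) = cstate (run M inp T)"
proof -
  have "codes_config T ((sim_step inpc m ^^ j) (config_code 0 0 0 T 0 0 0)) (run M inp j)" if "j \<le> T" for j
    using that
  proof (induction j)
    case 0
    show ?case by (auto simp: codes_config_def run_def init_config_def sym_at_def intro!: exI[of _ 0])
  next
    case (Suc j)
    have "0 < int T + fst (snd (snd (run M inp j)))"
      using run_head[of M inp j] Suc.prems by linarith
    then show ?case using Suc codes_config_step[OF _ assms(2) run_state[OF assms(1)] _ assms(3)]
      by (simp add: run_Suc)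
  qed
  then have "codes_config T (sim inpc m T) (run M inp T)" unfolding sim_def by simp
  then show ?thesis by (auto simp: codes_config_def config_code_def cstate_def)
qed

section \<open>Hitting sets and random words\<close>

definition word_sym :: "nat \<Rightarrow> nat \<Rightarrow> nat \<Rightarrow> nat" where
  "word_sym n u i = (if i < n then if bit u i then 2 else 1 else 0)"

definition pair_sym :: "nat \<Rightarrow> nat \<Rightarrow> nat \<Rightarrow> nat \<Rightarrow> nat \<Rightarrow> nat" where
  "pair_sym n u l b i = (if i mod 2 = 0 then word_sym n u (i div 2) else word_sym l b (i div 2))"

definition num_sym :: "nat \<Rightarrow> nat \<Rightarrow> nat" where
  "num_sym n i = (if 2 ^ i \<le> n then if bit n i then 2 else 1 else 0)"

lemma code_decode: "0 < v \<Longrightarrow> code (decode v) = v"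
proof (induction v rule: less_induct)
  case (less v)
  show ?case
  proof (cases "v \<le> 1")
    case True
    then show ?thesis using less.prems by (subst decode.simps) simp
  next
    case False
    then have "code (decode v) = 2 * (v div 2) + of_bool (odd v)"
      using less.IH[of "v div 2"] by (subst decode.simps) simp
    then show ?thesis by simp
  qed
qed

lemma code_bounds: "2 ^ length x \<le> code x" "code x < 2 ^ Suc (length x)"
  by (induction x) auto

definition bits :: "nat \<Rightarrow> nat \<Rightarrow> bool list" where
  "bits n u = decode (2 ^ n + u)"

lemma bits_eq_map: "u < 2 ^ n \<Longrightarrow> bits n u = map (bit u) [0..<n]"
proof (induction n arbitrary: u)
  case 0
  then show ?case by (simp add: bits_def decode.simps)
next
  case (Suc n)
  then have "bits n (u div 2) = map (bit (u div 2)) [0..<n]" by simp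
  moreover have "(2 ^ Suc n + u) div 2 = 2 ^ n + u div 2" by simp
  moreover have "\<not> 2 ^ Suc n + u \<le> 1"
  proof -
    have "1 \<le> (2 :: nat) ^ n" by simp
    then show ?thesis unfolding power_Suc by linarith
  qed
  ultimately have "bits (Suc n) u = odd u # map (bit (u div 2)) [0..<n]"
    unfolding bits_def by (subst decode.simps) simp
  then show ?case
    by (simp add: upt_conv_Cons map_Suc_upt[symmetric] bit_0 bit_Suc o_def del: upt_Suc)
qed

lemma length_bits: "u < 2 ^ n \<Longrightarrow> length (bits n u) = n"
  by (simp add: bits_eq_map)

lemma code_bits: "code (bits n u) = 2 ^ n + u"
  unfolding bits_def by (rule code_decode) simp

lemma bij_bits: "bij_betw (bits n) {..<2 ^ n} {x. length x = n}"
proof (rule bij_betwI')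
  show "bits n u = bits n u' \<longleftrightarrow> u = u'" for u u'
    using code_bits[of n] add_left_cancel by metis
  show "bits n u \<in> {x. length x = n}" if "u \<in> {..<2 ^ n}" for u
    using that by (simp add: length_bits)
  show "\<exists>u\<in>{..<2 ^ n}. x = bits n u" if "x \<in> {x. length x = n}" for x
  proof
    have n: "length x = n" using that by simp
    show "x = bits n (code x - 2 ^ n)"
      using code_bounds(1)[of x] by (simp add: bits_def n decode_code)
    show "code x - 2 ^ n \<in> {..<2 ^ n}" using code_bounds(2)[of x] by (simp add: n)
  qed
qed

lemma sym_code_bits: "u < 2 ^ n \<Longrightarrow> sym_code (enc1 (bits n u) i) = word_sym n u i"
  by (simp add: enc1_def word_sym_def bits_eq_map bitsym_def)

lemma sym_code_pair:
  "u < 2 ^ n \<Longrightarrow> b < 2 ^ l \<Longrightarrow> sym_code (enc2 (bits n u) (bits l b) i) = pair_sym n u l b i"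
  by (simp add: enc2_def pair_sym_def sym_code_bits even_iff_mod_2_eq_zero)

declare nat_bits.simps [simp del]

lemma nat_bits_nth:
  "(i < length (nat_bits n) \<longleftrightarrow> 2 ^ i \<le> n) \<and> (i < length (nat_bits n) \<longrightarrow> nat_bits n ! i = bit n i)"
proof (induction n arbitrary: i rule: less_induct)
  case (less n)
  show ?case
  proof (cases "n = 0")
    case True
    then show ?thesis by (simp add: nat_bits.simps)
  next
    case False
    then have n: "nat_bits n = odd n # nat_bits (n div 2)" by (subst nat_bits.simps) simp
    show ?thesis
    proof (cases i)
      case 0
      then show ?thesis using False by (simp add: n bit_0)
    next
      case (Suc j)
      moreover have "2 ^ j \<le> n div 2 \<longleftrightarrow> 2 ^ Suc j \<le> n"
        by (simp add: less_eq_div_iff_mult_less_eq mult.commute)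
      ultimately show ?thesis using less[of "n div 2" j] False by (simp add: n bit_Suc)
    qed
  qed
qed

lemma sym_code_nat_bits: "sym_code (enc1 (nat_bits n) i) = num_sym n i"
  using nat_bits_nth[of i n] by (auto simp: enc1_def num_sym_def bitsym_def)

section \<open>A computable time bound\<close>

definition halts_within :: "nat \<Rightarrow> nat \<Rightarrow> nat \<Rightarrow> bool" where
  "halts_within m n s \<longleftrightarrow> pfst (sim (num_sym n) m s) = 1 \<or> pfst (sim (num_sym n) m s) = 2"

text \<open>Any computable bound above \<open>t\<close> serves. This one needs only the halting time
  of a machine for \<open>t\<close>, so the simulation never has to read an output tape.\<close>

definition time_bound :: "nat \<Rightarrow> nat \<Rightarrow> nat" where
  "time_bound m n = 2 ^ (LEAST s. halts_within m n s)"

lemma halts_within_iff: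
  "wf_tm M \<Longrightarrow> codes_tm M m \<Longrightarrow> halts_within m n s \<longleftrightarrow> halted_state (cstate (run M (enc1 (nat_bits n)) s))"
  unfolding halts_within_def halted_state_def
  using sim_run[of M m "enc1 (nat_bits n)" "num_sym n" s] sym_code_nat_bits by simp

lemma run_blank: "fst (snd (snd (run M inp n))) \<le> int n \<and> (\<forall>i\<ge>int n. fst (snd (run M inp n)) i = Bl)"
proof (induction n)
  case (Suc n)
  obtain q W wh I ih where c: "run M inp n = (q, W, wh, I, ih)" by (cases "run M inp n")
  have mv: "mv_int wh d \<le> wh + 1" for d by (cases d) auto
  have IH: "wh \<le> int n" "\<And>i. int n \<le> i \<Longrightarrow> W i = Bl" using Suc by (simp_all add: c)
  obtain q' w dw j dj where d: "delta M q (inp (addr I)) (W wh) (I ih) = (q', w, dw, j, dj)"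
    by (cases "delta M q (inp (addr I)) (W wh) (I ih)")
  have "mv_int wh dw \<le> int (Suc n)" using mv[of dw] IH(1) by simp
  moreover have "wh \<le> int (Suc n)" using IH(1) by simp
  moreover have "\<forall>i\<ge>int (Suc n). W i = Bl \<and> (W(wh := w)) i = Bl" using IH by simp
  ultimately show ?case by (simp add: run_Suc c step_def d)
qed (simp add: run_def init_config_def)

text \<open>After \<open>s\<close> steps at most \<open>s\<close> bits are on the tape, so a halting time \<open>s\<close> bounds the output by \<open>2 ^ s\<close>.\<close>
lemma output_less:
  assumes "wf_tm M" "codes_tm M m" "eval M (nat_bits n) = Some (nat_bits k)"
  shows "k < time_bound m n"
proof -
  let ?r = "run M (enc1 (nat_bits n))"
  let ?s = "LEAST s. halted_state (cstate (?r s))"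
  have out: "tm_output (?r ?s) = nat_bits k"
    using assms(3) by (auto simp: eval_def split: if_splits)
  have "length (tm_output (?r ?s)) \<le> ?s"
  proof -
    obtain q W wh I ih where c: "?r ?s = (q, W, wh, I, ih)" by (cases "?r ?s")
    have "W (int ?s) = Bl" using run_blank[of M "enc1 (nat_bits n)" ?s] by (simp add: c)
    then have "(LEAST j. W (int j) = Bl) \<le> ?s" by (rule Least_le)
    then show ?thesis by (simp add: c tm_output_def)
  qed
  then have "\<not> 2 ^ ?s \<le> k" using nat_bits_nth[of ?s k] by (simp add: out)
  then show ?thesis unfolding time_bound_def halts_within_iff[OF assms(1,2)] by simp
qed

lemma recfn_word_sym: "recfn n \<Longrightarrow> recfn u \<Longrightarrow> recfn i \<Longrightarrow> recfn (\<lambda>z. word_sym (n z) (u z) (i z))"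
  unfolding word_sym_def by (intro recfn_rules)

lemma recfn_pair_sym:
  "recfn n \<Longrightarrow> recfn u \<Longrightarrow> recfn l \<Longrightarrow> recfn b \<Longrightarrow> recfn i \<Longrightarrow>
   recfn (\<lambda>z. pair_sym (n z) (u z) (l z) (b z) (i z))"
  unfolding pair_sym_def by (intro recfn_rules recfn_word_sym)

lemma recfn_num_sym: "recfn n \<Longrightarrow> recfn i \<Longrightarrow> recfn (\<lambda>z. num_sym (n z) (i z))"
  unfolding num_sym_def by (intro recfn_rules)

lemma recfn_time_bound:
  assumes "\<And>n. \<exists>s. halts_within m n s"
  shows "recfn (time_bound m)"
proof -
  have "recfn (\<lambda>n. 2 ^ (LEAST s. halts_within m n s))"
  proof (intro recfn_power recfn_const recfn_Least)
    show "decp (\<lambda>w. halts_within m (pfst w) (psnd w))"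
      unfolding halts_within_def by (intro recfn_rules recfn_sim recfn_num_sym)
  qed (rule assms)
  then show ?thesis unfolding time_bound_def .
qed

section \<open>Short lists that hit all dense accepted sets\<close>

definition accepts :: "nat \<Rightarrow> nat \<Rightarrow> nat \<Rightarrow> nat \<Rightarrow> nat \<Rightarrow> nat \<Rightarrow> bool" where
  "accepts n T e u l b \<longleftrightarrow> pfst (sim (pair_sym n u l b) e T) = 1"

lemma accepts_iff:
  assumes "wf_tm M" "codes_tm M e" "u < 2 ^ n" "b < 2 ^ l"
  shows "accepts n T e u l b \<longleftrightarrow> cstate (run M (enc2 (bits n u) (bits l b)) T) = 1"
  unfolding accepts_def by (subst sim_run[OF assms(1,2) sym_code_pair[OF assms(3,4)]]) simp

lemma decp_accepts:
  "recfn n \<Longrightarrow> recfn T \<Longrightarrow> recfn e \<Longrightarrow> recfn u \<Longrightarrow> recfn l \<Longrightarrow> recfn b \<Longrightarrow>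
   decp (\<lambda>z. accepts (n z) (T z) (e z) (u z) (l z) (b z))"
  unfolding accepts_def
  by (intro decp_eq recfn_fst recfn_sim recfn_pair_sym recfn_const) (intro recfn_rules | erule recfn_comp)+

text \<open>Here \<open>e\<close> is a machine code, \<open>l\<close> and \<open>b\<close> are length and content of the advice, and density at
  least \<open>2 ^ - k\<close> is stated without division; \<open>h\<close> codes the list of the \<open>m\<close> numbers \<open>elem n h i\<close>.\<close>
definition hits_all :: "nat \<Rightarrow> nat \<Rightarrow> nat \<Rightarrow> nat \<Rightarrow> nat \<Rightarrow> nat \<Rightarrow> bool" where
  "hits_all k B n T m h \<longleftrightarrow> (\<forall>e<n. \<forall>l<B + 1. \<forall>b<2 ^ B.
     2 ^ n \<le> 2 ^ k * (\<Sum>u<2 ^ n. if accepts n T e u l b then 1 else 0 :: nat) \<longrightarrow>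
     (\<exists>i<m. accepts n T e (elem n h i) l b))"

lemma decp_hits_all:
  assumes "recfn B" "recfn n" "recfn T" "recfn m" "recfn h"
  shows "decp (\<lambda>z. hits_all k (B z) (n z) (T z) (m z) (h z))"
proof -
  note c = assms[THEN recfn_comp]
  show ?thesis unfolding hits_all_def
    by (intro decp_ball decp_bex recfn_sum recfn_rules decp_accepts recfn_elem assms c)
qed

text \<open>Double counting of the pairs with \<open>x \<notin> S j\<close>: each set misses at most
  a fraction \<open>1 - 1 / K\<close> of the points, so some point is missed by at most that
  fraction of the sets.\<close>

lemma averaging:
  fixes K :: real
  assumes "finite J" "finite X" "X \<noteq> {}" and K: "0 < K"
    and S: "\<And>j. j \<in> J \<Longrightarrow> S j \<subseteq> X" "\<And>j. j \<in> J \<Longrightarrow> card X \<le> K * card (S j)"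
  shows "\<exists>x\<in>X. card {j \<in> J. x \<notin> S j} \<le> card J * (1 - 1 / K)"
proof (rule ccontr)
  assume "\<not> ?thesis"
  then have "(\<Sum>x\<in>X. card J * (1 - 1 / K)) < (\<Sum>x\<in>X. real (card {j \<in> J. x \<notin> S j}))"
    using assms(2,3) by (intro sum_strict_mono) auto
  also have "\<dots> = (\<Sum>x\<in>X. \<Sum>j\<in>J. if x \<notin> S j then 1 else 0)"
    using assms(1) by (intro sum.cong) (simp_all add: sum.If_cases Int_def)
  also have "\<dots> = (\<Sum>j\<in>J. \<Sum>x\<in>X. if x \<notin> S j then 1 else 0)" by (rule sum.swap)
  also have "\<dots> = (\<Sum>j\<in>J. real (card (X - S j)))"
    using assms(2) by (intro sum.cong) (simp_all add: sum.If_cases Int_def set_diff_eq)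
  also have "\<dots> \<le> (\<Sum>j\<in>J. card X * (1 - 1 / K))"
  proof (rule sum_mono)
    fix j assume j: "j \<in> J"
    have "real (card (X - S j)) = real (card X) - card (S j)"
      using S(1)[OF j] assms(2) by (simp add: card_Diff_subset finite_subset card_mono of_nat_diff)
    moreover have "card X / K \<le> card (S j)" using S(2)[OF j] K by (simp add: field_simps)
    ultimately show "real (card (X - S j)) \<le> card X * (1 - 1 / K)" by (simp add: algebra_simps)
  qed
  finally show False by (simp add: mult.commute mult.left_commute)
qed

text \<open>Each new point comes from \<open>averaging\<close> applied to the sets not hit so
  far.\<close>

lemma greedy_hitting:
  fixes K :: real
  assumes "finite J" "finite X" "X \<noteq> {}" and K: "1 \<le> K"
    and S: "\<And>j. j \<in> J \<Longrightarrow> S j \<subseteq> X" "\<And>j. j \<in> J \<Longrightarrow> card X \<le> K * card (S j)"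
  shows "\<exists>f. (\<forall>i. f i \<in> X) \<and> card {j \<in> J. \<forall>i<m. f i \<notin> S j} \<le> card J * (1 - 1 / K) ^ m"
proof (induction m)
  case 0
  then show ?case using assms(3) by auto
next
  case (Suc m)
  then obtain f where f: "\<And>i. f i \<in> X"
    and le: "card {j \<in> J. \<forall>i<m. f i \<notin> S j} \<le> card J * (1 - 1 / K) ^ m" by auto
  let ?J = "{j \<in> J. \<forall>i<m. f i \<notin> S j}"
  obtain x where x: "x \<in> X" "card {j \<in> ?J. x \<notin> S j} \<le> card ?J * (1 - 1 / K)"
    using averaging[of ?J X K S] assms by auto
  have "{j \<in> ?J. x \<notin> S j} = {j \<in> J. \<forall>i<Suc m. (f(m := x)) i \<notin> S j}"
    by (auto simp: less_Suc_eq)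
  moreover have "card ?J * (1 - 1 / K) \<le> card J * (1 - 1 / K) ^ Suc m"
    using mult_right_mono[OF le, of "1 - 1 / K"] K by (simp add: algebra_simps)
  ultimately show ?case using x f by (intro exI[of _ "f(m := x)"]) auto
qed

text \<open>With density \<open>1 / K\<close> and \<open>K * L\<close> points, the fraction of unhit
  sets is at most \<open>(1 - 1 / K) ^ (K * L) \<le> exp (- L) \<le> 1 / 2 ^ L\<close>. Fewer than
  \<open>2 ^ L\<close> sets then leave fewer than one unhit.\<close>

lemma ex_hitting:
  assumes "finite J" "finite X" "X \<noteq> {}" "card J < 2 ^ L"
    and S: "\<And>j. j \<in> J \<Longrightarrow> S j \<subseteq> X" "\<And>j. j \<in> J \<Longrightarrow> card X \<le> 2 ^ k * card (S j)"
  shows "\<exists>f. (\<forall>i. f i \<in> X) \<and> (\<forall>j\<in>J. \<exists>i<2 ^ k * L. f i \<in> S j)"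
proof -
  let ?K = "2 ^ k :: real" and ?m = "2 ^ k * L"
  have S2: "real (card X) \<le> ?K * card (S j)" if "j \<in> J" for j
    using S(2)[OF that] by (metis of_nat_le_iff of_nat_mult of_nat_numeral of_nat_power)
  obtain f where f: "\<forall>i. f i \<in> X"
    and le: "card {j \<in> J. \<forall>i<?m. f i \<notin> S j} \<le> card J * (1 - 1 / ?K) ^ ?m"
    using greedy_hitting[of J X ?K S ?m, OF assms(1-3) _ S(1) S2] by auto
  have "(1 - 1 / ?K) ^ ?m \<le> exp (- (1 / ?K)) ^ ?m"
    using exp_ge_add_one_self[of "- (1 / ?K)"] by (intro power_mono) auto
  also have "\<dots> = exp (- real L)" by (simp add: exp_of_nat_mult[symmetric])
  also have "\<dots> \<le> 1 / 2 ^ L"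
  proof -
    have "(2 :: real) ^ L \<le> exp 1 ^ L" using exp_ge_add_one_self[of 1] by (intro power_mono) auto
    also have "\<dots> = exp (real L)" by (simp add: exp_of_nat_mult[symmetric])
    finally show ?thesis by (simp add: exp_minus field_simps)
  qed
  finally have "card {j \<in> J. \<forall>i<?m. f i \<notin> S j} \<le> card J * (1 / 2 ^ L :: real)"
    using le by (meson mult_left_mono of_nat_0_le_iff order_trans)
  also have "\<dots> < 1" using assms(4) by simp
  finally have "card {j \<in> J. \<forall>i<?m. f i \<notin> S j} = 0" by simp
  then have "{j \<in> J. \<forall>i<?m. f i \<notin> S j} = {}" using assms(1) by simp
  with f show ?thesis by blast
qed

text \<open>There are \<open>n * (B + 1) * 2 ^ B\<close> triples of machine code, advice length and
  advice content; \<open>n \<le> 2 ^ n\<close> and \<open>B + 1 \<le> 2 ^ B\<close> give the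
  exponent \<open>n + 2 * B + 1\<close>. Nothing is assumed about \<open>T\<close>.\<close>

lemma ex_hits_all: "\<exists>h. hits_all k B n T (2 ^ k * (n + 2 * B + 1)) h"
proof -
  let ?S = "\<lambda>(e, l, b). {u. u < 2 ^ n \<and> accepts n T e u l b}"
  let ?J = "{(e, l, b). e < n \<and> l < B + 1 \<and> b < 2 ^ B \<and> 2 ^ n \<le> 2 ^ k * card (?S (e, l, b))}"
  let ?I = "{..<n} \<times> {..<B + 1} \<times> {..<2 ^ B :: nat}"
  have J: "?J \<subseteq> ?I" by auto
  have "card ?J \<le> card ?I" by (rule card_mono[OF _ J]) simp
  also have "\<dots> = n * (B + 1) * 2 ^ B" by (simp add: card_cartesian_product algebra_simps)
  also have "\<dots> < 2 ^ (n + 2 * B + 1)"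
  proof -
    have "n \<le> 2 ^ n" "B + 1 \<le> 2 ^ B" using less_exp[of n] less_exp[of B] by linarith+
    then have "n * (B + 1) * 2 ^ B \<le> 2 ^ n * 2 ^ B * 2 ^ B" by (intro mult_mono) auto
    also have "\<dots> = 2 ^ (n + 2 * B)" by (simp add: power_add mult_2)
    also have "\<dots> < 2 ^ (n + 2 * B + 1)" by simp
    finally show ?thesis .
  qed
  finally have "card ?J < 2 ^ (n + 2 * B + 1)" .
  moreover have "finite ?J" by (rule finite_subset[OF J]) simp
  moreover have "{..<2 ^ n :: nat} \<noteq> {}" by (auto simp: lessThan_empty_iff)
  moreover have "?S j \<subseteq> {..<2 ^ n}" for j by (cases j) auto
  moreover have "card {..<2 ^ n :: nat} \<le> 2 ^ k * card (?S j)" if "j \<in> ?J" for j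
    using that by (cases j) auto
  ultimately have "\<exists>f. (\<forall>i. f i \<in> {..<2 ^ n}) \<and> (\<forall>j\<in>?J. \<exists>i<2 ^ k * (n + 2 * B + 1). f i \<in> ?S j)"
    by (intro ex_hitting) simp_all
  then obtain f where f: "\<forall>i. f i \<in> {..<2 ^ n}"
    and hit: "\<forall>j\<in>?J. \<exists>i<2 ^ k * (n + 2 * B + 1). f i \<in> ?S j" by blast
  obtain h where h: "\<forall>i<2 ^ k * (n + 2 * B + 1). elem n h i = f i"
    using ex_elem[of "2 ^ k * (n + 2 * B + 1)" f n] f by auto
  have "hits_all k B n T (2 ^ k * (n + 2 * B + 1)) h"
    unfolding hits_all_def
  proof (intro allI impI)
    fix e l b assume elb: "e < n" "l < B + 1" "b < 2 ^ B"
      and d: "2 ^ n \<le> 2 ^ k * (\<Sum>u<2 ^ n. if accepts n T e u l b then 1 else 0 :: nat)"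
    have "(\<Sum>u<2 ^ n. if accepts n T e u l b then 1 else 0 :: nat) = card (?S (e, l, b))"
      by (simp add: sum.If_cases Int_def)
    with d elb have "(e, l, b) \<in> ?J" by simp
    then obtain i where "i < 2 ^ k * (n + 2 * B + 1)" "f i \<in> ?S (e, l, b)" using hit by blast
    then show "\<exists>i<2 ^ k * (n + 2 * B + 1). accepts n T e (elem n h i) l b" using h by auto
  qed
  then show ?thesis by blast
qed

text \<open>Taking the least code makes the list canonical, so the program and the counting argument
  speak of the same list.\<close>

definition hit :: "nat \<Rightarrow> nat \<Rightarrow> nat \<Rightarrow> nat \<Rightarrow> nat" where
  "hit k B n T = (LEAST h. hits_all k B n T (2 ^ k * (n + 2 * B + 1)) h)"

lemma hits_all_hit: "hits_all k B n T (2 ^ k * (n + 2 * B + 1)) (hit k B n T)"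
  unfolding hit_def by (rule LeastI_ex) (rule ex_hits_all)

lemma recfn_hit:
  assumes "recfn B" "recfn n" "recfn T"
  shows "recfn (\<lambda>z. hit k (B z) (n z) (T z))"
proof -
  note c = assms[THEN recfn_comp]
  show ?thesis unfolding hit_def
    by (rule recfn_Least[OF _ ex_hits_all]) (intro decp_hits_all recfn_rules c)
qed


section \<open>Density of random words\<close>

lemma many_random:
  assumes U: "universal U"
  obtains k where "\<And>n. k \<le> n \<Longrightarrow> 2 ^ n \<le> 2 ^ k * card {x \<in> R_K U. length x = n}"
proof -
  \<comment> \<open>All extensions of the prefix that simulates \<open>N\<close> print the empty
    word, so none of them is a program for a word of positive length.\<close>
  define N :: tm where "N = \<lparr>nst = 3, delta = \<lambda>q x y z. (1, y, Stay, z, Stay)\<rparr>"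
  have "wf_tm N" by (simp add: wf_tm_def N_def)
  have "eval N p = Some []" for p
  proof (rule eval_eqI[where n = 1])
    have *: "run N (enc1 p) 1 = (1, \<lambda>_. Bl, 0, \<lambda>_. Bl, 0)"
      by (auto simp: run_def init_config_def step_def halted_state_def N_def fun_eq_iff)
    show "halted_state (cstate (run N (enc1 p) 1))" unfolding * by (simp add: cstate_def halted_state_def)
    show "tm_output (run N (enc1 p) 1) = []" unfolding * by (rule tm_output_enc1) (simp add: enc1_def)
  qed
  then obtain c where c: "\<And>p. eval U (c @ p) = Some []"
    using U \<open>wf_tm N\<close> unfolding universal_def by metis
  \<comment> \<open>\<open>K\<close> is a \<open>LEAST\<close> and means something only if a program
    exists; a machine with constant output provides one.\<close>
  have ex: "\<exists>p. length p = K U x \<and> eval U p = Some x" for x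
  proof -
    obtain M where "wf_tm M" "\<And>p. eval M p = Some (decode (code x))"
      using recfn_tm[OF recfn_const[of "code x"]] by auto
    then obtain p where "eval U p = Some x"
      using U unfolding universal_def by (metis decode_code)
    then show ?thesis unfolding K_def
      by (intro LeastI_ex[of "\<lambda>n. \<exists>p. length p = n \<and> eval U p = Some x"]) blast
  qed
  then obtain prog where prog: "\<And>x. length (prog x) = K U x" "\<And>x. eval U (prog x) = Some x"
    by metis
  have "2 ^ n \<le> 2 ^ (length c + 1) * card {x \<in> R_K U. length x = n}" if n: "length c + 1 \<le> n" for n
  proof -
    let ?N = "{x. x \<notin> R_K U \<and> length x = n}" and ?R = "{x \<in> R_K U. length x = n}"
    \<comment> \<open>It suffices to discard the extensions of length exactly \<open>n - 1\<close>.
      There are \<open>2 ^ (n - 1 - length c)\<close> of them, whence the constant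
      \<open>length c + 1\<close>.\<close>
    let ?P = "{p :: bool list. length p < n}" and ?C = "(@) c ` {p. length p = n - 1 - length c}"
    have fin: "finite {x :: bool list. length x = m}" and
      card: "card {x :: bool list. length x = m} = 2 ^ m" for m
      using bij_betw_finite[OF bij_bits[of m]] bij_betw_same_card[OF bij_bits[of m]] by auto
    have "?P = (\<Union>m<n. {p. length p = m})" by auto
    then have finP: "finite ?P" and "card ?P = (\<Sum>m<n. 2 ^ m)"
      using card_UN_disjoint[of "{..<n}" "\<lambda>m. {p :: bool list. length p = m}"] fin card by auto
    then have cardP: "card ?P = 2 ^ n - 1" by (simp add: sum_power2 lessThan_atLeast0)
    have C: "?C \<subseteq> ?P" using n by auto
    have cardC: "card ?C = 2 ^ (n - 1 - length c)"
      by (subst card_image) (auto simp: card inj_on_def)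
    have "inj_on prog ?N" by (rule inj_onI) (metis prog(2) option.inject)
    moreover have "prog ` ?N \<subseteq> ?P - ?C"
    proof (rule image_subsetI)
      fix x assume x: "x \<in> ?N"
      have "x \<noteq> []" using x n by auto
      then have "prog x \<notin> ?C" using prog(2)[of x] c by auto
      moreover have "length (prog x) < n" using x prog(1)[of x] by (auto simp: R_K_def)
      ultimately show "prog x \<in> ?P - ?C" by simp
    qed
    moreover have "finite (?P - ?C)" using finP by simp
    ultimately have "card ?N \<le> card (?P - ?C)" by (rule card_inj_on_le)
    also have "\<dots> = 2 ^ n - 1 - 2 ^ (n - 1 - length c)"
      using card_Diff_subset[OF finite_subset[OF C finP] C] by (simp only: cardP cardC)
    finally have 1: "card ?N \<le> 2 ^ n - 1 - 2 ^ (n - 1 - length c)" .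
    have "{x :: bool list. length x = n} = ?N \<union> ?R" by auto
    then have "card (?N \<union> ?R) = 2 ^ n" "finite (?N \<union> ?R)" using card[of n] fin[of n] by metis+
    then have "card ?N + card ?R = 2 ^ n"
      by (subst card_Un_disjoint[symmetric]) auto
    moreover have "(2 :: nat) ^ (n - 1 - length c) \<le> 2 ^ n - 1"
    proof -
      have "(2 :: nat) ^ (n - 1 - length c) < 2 ^ n" using n by (intro power_strict_increasing) auto
      then show ?thesis by linarith
    qed
    ultimately have "2 ^ (n - 1 - length c) \<le> card ?R" using 1 by linarith
    then have "2 ^ (length c + 1) * 2 ^ (n - 1 - length c) \<le> 2 ^ (length c + 1) * card ?R" by simp
    moreover have "length c + 1 + (n - 1 - length c) = n" using n by simp
    ultimately show ?thesis by (simp only: power_add[symmetric])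
  qed
  then show ?thesis by (rule that)
qed

section \<open>Short descriptions of the listed words\<close>

text \<open>The program for element \<open>i\<close> of the list for length \<open>n\<close> codes \<open>(2 * (2 ^ l + i) + 1) * 2 ^ a\<close>, where
  \<open>n = l + 2 ^ a\<close>: it is \<open>2 ^ a - a - 1\<close> bits shorter than \<open>n\<close>, and the saving \<open>2 ^ a\<close> can be
  chosen after the machine.\<close>
definition low_bit :: "nat \<Rightarrow> nat" where
  "low_bit v = (LEAST i. v \<le> i \<or> bit v i)"

definition high_bit :: "nat \<Rightarrow> nat" where
  "high_bit w = (LEAST l. w < 2 ^ (l + 1))"

text \<open>With \<open>s = 2 ^ a\<close> and \<open>n = l + s\<close> the exponent is
  \<open>n - d\<close> for \<open>d = s + k + 2\<close>: the advice bound is rebuilt from the input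
  alone. The summand \<open>2 ^ (l + s)\<close> is the end mark of a word of length
  \<open>n\<close>.\<close>

definition output_code :: "nat \<Rightarrow> (nat \<Rightarrow> nat) \<Rightarrow> nat \<Rightarrow> nat \<Rightarrow> nat \<Rightarrow> nat" where
  "output_code k T s l i = 2 ^ (l + s) +
     elem (l + s) (hit k (2 ^ (l + s - (s + k + 2))) (l + s) (T (l + s))) i"

definition machine_fun :: "nat \<Rightarrow> (nat \<Rightarrow> nat) \<Rightarrow> nat \<Rightarrow> nat" where
  "machine_fun k T v =
     (let a = low_bit v; w = v div 2 ^ (a + 1); l = high_bit w
      in output_code k T (2 ^ a) l (w - 2 ^ l))"

lemma recfn_machine_fun:
  assumes T: "recfn T"
  shows "recfn (machine_fun k T)"
proof -
  have low: "recfn low_bit"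
  proof -
    have "recfn (\<lambda>v. LEAST i. v \<le> i \<or> bit v i)"
      by (intro recfn_Least recfn_rules) auto
    then show ?thesis unfolding low_bit_def .
  qed
  have high: "recfn high_bit"
  proof -
    have "recfn (\<lambda>w. LEAST l. w < 2 ^ (l + 1))"
    proof (intro recfn_Least recfn_rules)
      show "\<exists>l. w < 2 ^ (l + 1)" for w :: nat
        using less_exp[of "w + 1"] by (intro exI[of _ w]) linarith
    qed
    then show ?thesis unfolding high_bit_def .
  qed
  note c = recfn_comp[OF T] recfn_comp[OF low] recfn_comp[OF high]
  have "recfn (\<lambda>v. machine_fun k T v)"
    unfolding machine_fun_def output_code_def Let_def
    by (intro recfn_add recfn_elem recfn_hit recfn_power recfn_const recfn_diff recfn_div recfn_id c)
  then show ?thesis .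
qed

lemma low_bit_eq: "low_bit ((2 * w + 1) * 2 ^ a) = a"
  unfolding low_bit_def
proof (rule Least_equality)
  show "(2 * w + 1) * 2 ^ a \<le> a \<or> bit ((2 * w + 1) * 2 ^ a) a"
    by (simp add: bit_iff_odd)
  fix i assume i: "(2 * w + 1) * 2 ^ a \<le> i \<or> bit ((2 * w + 1) * 2 ^ a) i"
  show "a \<le> i"
  proof (rule ccontr)
    assume "\<not> a \<le> i"
    then obtain j where j: "a = Suc (i + j)" using less_natE by (metis not_le)
    have "(2 * w + 1) * 2 ^ a = (2 * ((2 * w + 1) * 2 ^ j)) * 2 ^ i"
      by (simp add: j power_add algebra_simps)
    then have "\<not> bit ((2 * w + 1) * 2 ^ a) i" by (simp add: bit_iff_odd)
    \<comment> \<open>The disjunct \<open>v \<le> i\<close>, which makes the search in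
      \<open>low_bit\<close> total, must not end it before position \<open>a\<close>.\<close>
    moreover have "a < (2 * w + 1) * 2 ^ a"
      by (rule order_less_le_trans[OF less_exp]) simp
    ultimately show False using i \<open>\<not> a \<le> i\<close> by simp
  qed
qed

lemma high_bit_eq: "i < 2 ^ l \<Longrightarrow> high_bit (2 ^ l + i) = l"
  unfolding high_bit_def
proof (rule Least_equality)
  fix m assume "2 ^ l + i < (2 :: nat) ^ (m + 1)"
  then have "(2 :: nat) ^ l < 2 ^ (m + 1)" by simp
  then have "l < m + 1" by (rule power_less_imp_less_exp[rotated]) simp
  then show "l \<le> m" by simp
qed simp

lemma machine_fun_eq:
  assumes "i < 2 ^ l"
  shows "machine_fun k T ((2 * (2 ^ l + i) + 1) * 2 ^ a) = output_code k T (2 ^ a) l i"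
proof -
  have "(2 * (2 ^ l + i) + 1) * 2 ^ a div 2 ^ (a + 1) = (2 * (2 ^ l + i) + 1) * 2 ^ a div (2 * 2 ^ a)"
    by simp
  also have "\<dots> = (2 * (2 ^ l + i) + 1) div 2"
    by (rule div_mult_mult2) simp
  finally have "(2 * (2 ^ l + i) + 1) * 2 ^ a div 2 ^ (a + 1) = (2 * (2 ^ l + i) + 1) div 2" .
  then show ?thesis
    unfolding machine_fun_def Let_def low_bit_eq by (simp add: high_bit_eq[OF assms])
qed

text \<open>The inequality is strict because the topmost bit of \<open>v\<close> is only the end
  mark. The reversal matches the input convention of \<open>recfn_tm\<close>.\<close>

lemma short_program:
  assumes "0 < v" "v < 2 ^ m"
  obtains p where "code (rev p) = v" "length p < m"
proof
  show "code (rev (rev (decode v))) = v" using assms(1) by (simp add: code_decode)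
  have "(2 :: nat) ^ length (decode v) < 2 ^ m"
    using code_bounds(1)[of "decode v"] assms(2)
    unfolding code_decode[OF assms(1)] by (rule order_le_less_trans)
  then show "length (rev (decode v)) < m"
    unfolding length_rev by (rule power_less_imp_less_exp[rotated]) simp
qed

section \<open>Choice of the constants and contradiction\<close>

lemma ex_larger:
  fixes m :: nat
  assumes "infinite {n. Q n}"
  shows "\<exists>n>m. Q n"
proof (rule ccontr)
  assume "\<not> ?thesis"
  then have "{n. Q n} \<subseteq> {..m}" by (auto simp: not_less)
  with assms show False by (simp add: finite_subset)
qed

theorem mainTheorem3:
  fixes U :: tm and t :: "nat \<Rightarrow> nat"
  assumes "universal U" and "computable_nat_fn t"
  shows "\<exists>d::nat. R_K U \<notin> io_DTIME_adv t (\<lambda>n. 2 powr (real n - real d))"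
proof -
  obtain Mt where Mt: "wf_tm Mt" "\<And>n. eval Mt (nat_bits n) = Some (nat_bits (t n))"
    using assms(2) unfolding computable_nat_fn_def by blast
  obtain mt where mt: "codes_tm Mt mt" using ex_codes_tm by blast
  let ?T = "time_bound mt"
  have t_less: "t n < ?T n" for n by (rule output_less[OF Mt(1) mt Mt(2)])
  have "\<exists>s. halts_within mt n s" for n
    unfolding halts_within_iff[OF Mt(1) mt] using Mt(2)[of n] by (auto simp: eval_def split: if_splits)
  then have T: "recfn ?T" by (rule recfn_time_bound)
  obtain k where k: "\<And>n. k \<le> n \<Longrightarrow> 2 ^ n \<le> 2 ^ k * card {x \<in> R_K U. length x = n}"
    using many_random[OF assms(1)] by blast
  obtain P where "wf_tm P" and P: "\<And>p. eval P p = Some (decode (machine_fun k ?T (code (rev p))))"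
    using recfn_tm[OF recfn_machine_fun[OF T, of k]] by blast
  then obtain c where c: "\<And>p. eval U (c @ p) = Some (decode (machine_fun k ?T (code (rev p))))"
    using assms(1) unfolding universal_def by metis
  \<comment> \<open>Then \<open>2 ^ a = 4 * 2 ^ length c\<close> exceeds
    \<open>length c + a + 1\<close>, the prefix plus the bits a program spends beyond the
    \<open>l\<close> bits of the index.\<close>
  define a where "a = length c + 2"
  \<comment> \<open>The list will have at most \<open>2 ^ k * (4 * B)\<close> words with
    \<open>B = 2 ^ (n - d)\<close>; this \<open>d\<close> turns that into
    \<open>2 ^ (n - 2 ^ a)\<close>, so indices fit into \<open>l = n - 2 ^ a\<close> bits.\<close>
  define d where "d = 2 ^ a + k + 2"
  have a: "length c + a + 1 < 2 ^ a"
  proof -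
    have "2 ^ a = 4 * (2 :: nat) ^ length c" by (simp add: a_def power_add)
    then show ?thesis using less_exp[of "length c"] unfolding a_def by linarith
  qed
  have "R_K U \<notin> io_DTIME_adv t (\<lambda>n. 2 powr (real n - real d))"
  proof
    assume "R_K U \<in> io_DTIME_adv t (\<lambda>n. 2 powr (real n - real d))"
    then obtain M \<alpha> where M: "wf_tm M"
      and \<alpha>: "\<And>n. real (length (\<alpha> n)) \<le> 2 powr (real n - real d)"
      and halt: "\<And>x \<beta>. halted_state (cstate (run M (enc2 x \<beta>) (t (length x))))"
      and inf: "infinite {n. \<forall>x. length x = n \<longrightarrow>
        (x \<in> R_K U \<longleftrightarrow> cstate (run M (enc2 x (\<alpha> n)) (t n)) = 1)}"
      unfolding io_DTIME_adv_def by blast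
    obtain e where e: "codes_tm M e" using ex_codes_tm by blast
    \<comment> \<open>\<open>d\<close> was fixed before the machine; only \<open>n\<close> depends
      on its code. \<open>e < n\<close> puts the machine among those covered by
      \<open>hits_all\<close>, and \<open>2 * d < n\<close> yields \<open>n + 1 \<le> 2 * B\<close>,
      which bounds the length of the list.\<close>
    obtain n where n: "2 * d + e < n" and "\<forall>x. length x = n \<longrightarrow>
        (x \<in> R_K U \<longleftrightarrow> cstate (run M (enc2 x (\<alpha> n)) (t n)) = 1)"
      using ex_larger[OF inf, of "2 * d + e"] by blast
    then have dec: "x \<in> R_K U \<longleftrightarrow> cstate (run M (enc2 x (\<alpha> n)) (t n)) = 1" if "length x = n" for x
      using that by blast
    define B :: nat where "B = 2 ^ (n - d)"
    define l where "l = n - 2 ^ a"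
    have ln: "l + 2 ^ a = n" using n by (simp add: l_def d_def)
    have "real (length (\<alpha> n)) \<le> 2 ^ (n - d)"
      using \<alpha>[of n] n by (simp add: powr_realpow[symmetric] of_nat_diff)
    then have lenB: "length (\<alpha> n) \<le> B" unfolding B_def by (metis of_nat_le_iff of_nat_numeral of_nat_power)
    define b where "b = code (\<alpha> n) - 2 ^ length (\<alpha> n)"
    have b: "b < 2 ^ length (\<alpha> n)" and ab: "bits (length (\<alpha> n)) b = \<alpha> n"
      using code_bounds[of "\<alpha> n"] by (auto simp: b_def bits_def decode_code)
    have "(2 :: nat) ^ length (\<alpha> n) \<le> 2 ^ B" using lenB by (intro power_increasing) auto
    then have bB: "b < 2 ^ B" by (rule order_less_le_trans[OF b])
    have acc: "accepts n (?T n) e u (length (\<alpha> n)) b \<longleftrightarrow> bits n u \<in> R_K U" if u: "u < 2 ^ n" for u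
    proof -
      have len: "length (bits n u) = n" using u by (rule length_bits)
      \<comment> \<open>The machine has halted by time \<open>t n < ?T n\<close>, so the later
        cutoff used in the search finds the same state.\<close>
      have "run M (enc2 (bits n u) (\<alpha> n)) (?T n) = run M (enc2 (bits n u) (\<alpha> n)) (t n)"
        by (rule halted_run_mono) (use halt[of "bits n u" "\<alpha> n"] t_less[of n] len in simp_all)
      then show ?thesis using accepts_iff[OF M e u b, of "?T n"] dec[OF len] by (simp add: ab)
    qed
    \<comment> \<open>Transported along \<open>bits n\<close>, the accepted set is the set of random
      words of length \<open>n\<close>, so it is dense enough for the list to have to hit
      it.\<close>
    have "(\<Sum>u<2 ^ n. if accepts n (?T n) e u (length (\<alpha> n)) b then 1 else 0 :: nat) =
        card {u \<in> {..<2 ^ n}. bits n u \<in> R_K U}"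
      using acc by (simp add: sum.If_cases Int_def cong: conj_cong)
    also have "\<dots> = card {x \<in> R_K U. length x = n}"
    proof (rule bij_betw_same_card, rule bij_betw_subset[OF bij_bits[of n]])
      have "bits n ` {..<2 ^ n} = {x. length x = n}"
        using bij_bits by (rule bij_betw_imp_surj_on)
      moreover have "f ` {u \<in> A. f u \<in> R} = {x \<in> R. x \<in> f ` A}" for f :: "nat \<Rightarrow> bool list" and A R
        by auto
      ultimately show "bits n ` {u \<in> {..<2 ^ n}. bits n u \<in> R_K U} = {x \<in> R_K U. length x = n}"
        by (simp only: mem_Collect_eq)
    qed blast
    finally have dens: "2 ^ n \<le> 2 ^ k * (\<Sum>u<2 ^ n. if accepts n (?T n) e u (length (\<alpha> n)) b then 1 else 0 :: nat)"
      using k[of n] n by (simp add: d_def)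
    have "e < n" "length (\<alpha> n) < B + 1" using n lenB by simp_all
    then have "\<exists>i<2 ^ k * (n + 2 * B + 1).
        accepts n (?T n) e (elem n (hit k B n (?T n)) i) (length (\<alpha> n)) b"
      using hits_all_hit[of k B n "?T n", unfolded hits_all_def, rule_format, OF _ _ bB dens] by blast
    then obtain i where i: "i < 2 ^ k * (n + 2 * B + 1)"
      and hit: "accepts n (?T n) e (elem n (hit k B n (?T n)) i) (length (\<alpha> n)) b" by blast
    define u where "u = elem n (hit k B n (?T n)) i"
    have u: "u < 2 ^ n" by (simp add: u_def elem_def)
    then have random: "bits n u \<in> R_K U" using acc hit by (simp add: u_def)
    have "i < 2 ^ l"
    proof -
      have "n + 1 \<le> 2 * B"
        using less_exp[of "n - d"] n unfolding B_def by linarith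
      then have "n + 2 * B + 1 \<le> 2 ^ 2 * B" by simp
      then have "2 ^ k * (n + 2 * B + 1) \<le> 2 ^ k * (2 ^ 2 * B)" by (rule mult_le_mono2)
      also have "\<dots> = 2 ^ (k + 2 + (n - d))" by (simp only: B_def power_add mult.assoc)
      also have "k + 2 + (n - d) = l" using n by (simp add: l_def d_def)
      finally show ?thesis using i by simp
    qed
    define v where "v = (2 * (2 ^ l + i) + 1) * 2 ^ a"
    have "v < 2 ^ (l + 2 + a)"
    proof -
      have "2 * (2 ^ l + i) + 1 < 2 ^ (l + 2)" using \<open>i < 2 ^ l\<close> by simp
      then have "v < 2 ^ (l + 2) * 2 ^ a" unfolding v_def by (rule mult_strict_right_mono) simp
      then show ?thesis by (simp only: power_add)
    qed
    moreover have "0 < v" by (simp add: v_def)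
    ultimately obtain p where p: "code (rev p) = v" "length p < l + 2 + a"
      using short_program by blast
    have "machine_fun k ?T v = 2 ^ n + u"
      using machine_fun_eq[OF \<open>i < 2 ^ l\<close>, of k ?T a]
      by (simp add: v_def output_code_def ln u_def B_def d_def)
    then have "eval U (c @ p) = Some (bits n u)" by (simp add: c p(1) bits_def)
    then have "K U (bits n u) \<le> length (c @ p)" unfolding K_def by (intro Least_le) blast
    also have "\<dots> < n" using p(2) a ln by simp
    finally show False using random by (simp add: R_K_def length_bits[OF u])
  qed
  then show ?thesis by blast
qed

end
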